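(* Let $k\ge3$ and consider a Poisson random hypergraph on $N$ vertices with parameters $(\beta_j)_{j\ge2}$ satisfying $\beta_j=1/(j(j-1))$ for $2\le j\le k-1$ and $\beta_k>1/(k(k-1))$. Let $z(t)=1-t-\exp(-\beta'(t))$, $t^*=\inf\{t\ge0:z(t)<0\}$, and assume $z$ has no zeros in $(0,t^* )$. Let $\delta>0$ be such that $\lim_{R\to\infty}\lim_{N\to\infty}\mathbb{P}(S_N^R\le N\delta)=0$, where $S_N^R=\inf\{i\ge N^{\alpha(k)}R^2:Z_N(i)\le0\}$. Let $\tilde Z_N$ be the modification of the breadth-first walk $Z_N$ in which no more patches are added after time $\lfloor N\delta\rfloor$: that is, $\tilde Z_N$ agrees with $Z_N$ up to the first time after $\lfloor N\delta\rfloor$ at which $Z_N$ goes below its past minimum $\min_{j\le \lfloor N\delta\rfloor}Z_N(j)$ (equivalently, the patch count $\tilde P_N(\lfloor Nt\rfloor)=P_N(\lfloor N\delta\rfloor)$ for all $t\ge\delta$), and from that time on $\tilde Z_N$ stays constant. Let $\tilde z(t)=z(t\wedge t^* )$. Then for all $\varepsilon>0$, $$\lim_{N\to\infty}\mathbb{P}\Big(\sup_{0\le t\le1}\Big|\tfrac1N\tilde Z_N(\lfloor Nt\rfloor)-\tilde z(t)\Big|>\varepsilon\Big)=0 .$$ Consequently, for any $0<\sigma<t^*$, $\sup_{0\le t\le\sigma}\big|\frac1NZ_N(\lfloor Nt\rfloor)-z(t)\big|\to0$ in probability.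
   Context: Poisson random hypergraph: vertex set $\{1,\dots,N\}$; $(\beta_j)_{j\ge2}$ nonnegative reals, $\beta(t)=\sum_{j\ge2}\beta_jt^j$ with $\beta'(1)<\infty$; for each $A$ with $|A|=j\ge2$, the number of hyperedges on $A$ is Poisson with mean $N\beta_j/\binom{N}{j}$, independently. A 1-edge is a patch; deleting a patched vertex $v$ removes it and replaces each other hyperedge containing $v$ by the hyperedge on its remaining vertices. Breadth-first walk: put a patch on the lowest-labelled vertex, call it $v(1)$. Having processed $v(1),\dots,v(i-1)$, the children of $v(i)$ are the not-yet-numbered vertices $w$ such that some original hyperedge consists of $v(i)$, $w$ and a subset of $\{v(1),\dots,v(i-1)\}$; they get the next numbers in order of original label, then $v(i)$ is deleted; if no numbered-but-undeleted vertex remains, a patch is placed on the lowest-labelled un-numbered vertex, which becomes the next numbered vertex. With $c(i)$ the number of children of $v(i)$: $Z_N(0)=0$, $Z_N(i)=Z_N(i-1)+c(i)-1$. The number of patches added before the $(i+1)$st deletion is $P_N(0)=1$, $P_N(i)=1-\min_{j\le i}Z_N(j)$. Also $\alpha(k)=(2k-4)/(2k-3)$. *)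

theory Defs
  imports "HOL-Probability.Probability"
begin

(* Poisson law with mean r \<ge> 0 (mean 0 = point mass at 0; the library's
   poisson_pmf is only specified for positive rate) *)
definition poisson0_pmf :: "real \<Rightarrow> nat pmf" where
  "poisson0_pmf r = (if r \<le> 0 then return_pmf 0 else poisson_pmf r)"

definition hedge_sets :: "nat \<Rightarrow> nat set set" where
  "hedge_sets N = {A. A \<subseteq> {1..N} \<and> card A \<ge> 2}"

(* Poisson random hypergraph: H A = number of hyperedges on A, independent
   Poisson with mean N beta_j / (N choose j), j = |A| *)
definition poisson_hypergraph :: "(nat \<Rightarrow> real) \<Rightarrow> nat \<Rightarrow> (nat set \<Rightarrow> nat) pmf" where
  "poisson_hypergraph \<beta> N =
     Pi_pmf (hedge_sets N) 0
       (\<lambda>A. poisson0_pmf (real N * \<beta> (card A) / real (N choose card A)))"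

(* children of the vertex v processed at step i+1, given the list vs of
   vertices numbered so far (vs ! j = v(j+1)) *)
definition bfw_children :: "nat \<Rightarrow> (nat set \<Rightarrow> nat) \<Rightarrow> nat list \<Rightarrow> nat \<Rightarrow> nat list" where
  "bfw_children N H vs i =
     (if i < length vs then
        sorted_list_of_set
          {w \<in> {1..N}. w \<notin> set vs \<and>
             (\<exists>E \<in> hedge_sets N. H E > 0 \<and> vs ! i \<in> E \<and> w \<in> E \<and>
                E - {vs ! i, w} \<subseteq> set (take i vs))}
      else [])"

(* bfw_order N H i = list of vertices numbered after i deletions
   (including any patch placed after the i-th deletion) *)
fun bfw_order :: "nat \<Rightarrow> (nat set \<Rightarrow> nat) \<Rightarrow> nat \<Rightarrow> nat list" where
  "bfw_order N H 0 = [1]"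
| "bfw_order N H (Suc i) =
     (let vs = bfw_order N H i;
          vs' = vs @ bfw_children N H vs i;
          rest = {1..N} - set vs'
      in if length vs' \<le> Suc i \<and> rest \<noteq> {} then vs' @ [Min rest] else vs')"

definition bfw_c :: "nat \<Rightarrow> (nat set \<Rightarrow> nat) \<Rightarrow> nat \<Rightarrow> nat" where
  "bfw_c N H i = length (bfw_children N H (bfw_order N H (i - 1)) (i - 1))"

fun bfw_Z :: "nat \<Rightarrow> (nat set \<Rightarrow> nat) \<Rightarrow> nat \<Rightarrow> int" where
  "bfw_Z N H 0 = 0"
| "bfw_Z N H (Suc i) = bfw_Z N H i + int (bfw_c N H (Suc i)) - 1"

(* modified walk: no more patches after time m = floor(N delta) *)
definition bfw_Ztilde :: "nat \<Rightarrow> real \<Rightarrow> (nat set \<Rightarrow> nat) \<Rightarrow> nat \<Rightarrow> int" where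
  "bfw_Ztilde N \<delta> H i =
     (let m = nat \<lfloor>real N * \<delta>\<rfloor>;
          M = Min (bfw_Z N H ` {..m})
      in if \<exists>j. m < j \<and> j \<le> i \<and> bfw_Z N H j < M then M else bfw_Z N H i)"

definition beta_deriv :: "(nat \<Rightarrow> real) \<Rightarrow> real \<Rightarrow> real" where
  "beta_deriv \<beta> t = (\<Sum>j. real (j + 2) * \<beta> (j + 2) * t ^ (j + 1))"

definition zfun :: "(nat \<Rightarrow> real) \<Rightarrow> real \<Rightarrow> real" where
  "zfun \<beta> t = 1 - t - exp (- beta_deriv \<beta> t)"

definition tstar :: "(nat \<Rightarrow> real) \<Rightarrow> real" where
  "tstar \<beta> = Inf {t. t \<ge> 0 \<and> zfun \<beta> t < 0}"

definition alpha :: "nat \<Rightarrow> real" where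
  "alpha k = (2 * real k - 4) / (2 * real k - 3)"

(* the event S_N^R \<le> N delta, where
   S_N^R = inf {i \<ge> N^alpha(k) R^2 : Z_N(i) \<le> 0} (inf {} = \<infinity>) *)
definition S_event :: "nat \<Rightarrow> nat \<Rightarrow> real \<Rightarrow> real \<Rightarrow> (nat set \<Rightarrow> nat) set" where
  "S_event k N R \<delta> =
     {H. \<exists>i \<le> N. real i \<ge> real N powr alpha k * R\<^sup>2 \<and> bfw_Z N H i \<le> 0
                 \<and> real i \<le> real N * \<delta>}"

end

theory Submission
  imports Defs
begin

text \<open>Given \<open>v(1), \<dots>, v(i)\<close>, each un-numbered vertex independently survives step \<open>i\<close> with
  a probability \<open>q(i)\<close> that depends on \<open>i\<close> and \<open>N\<close> alone. Without patches the number
  of un-numbered vertices after \<open>i\<close> deletions would thus be close to \<open>N q(0) \<dots> q(i - 1)\<close>, and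
  this product tends to \<open>exp (- \<beta>' t)\<close> when \<open>i / N\<close> tends to \<open>t < 1\<close>. To account for the
  patches, every patched vertex is put back with its survival probability; the resulting number \<open>K\<close>
  is decreasing in \<open>i\<close>, lies between \<open>U\<close> and \<open>U + P\<close> (un-numbered vertices and patches), and
  \<open>K - N q(0) \<dots> q(i - 1)\<close> has second moment at most \<open>N\<close>. Chebyshev's inequality on a finite grid
  and monotonicity give a uniform fluid limit for \<open>K\<close>, hence for \<open>Z\<close> as long as \<open>P = o(N)\<close>. The
  hypothesis on \<open>S\<close> bounds \<open>P\<close> by \<open>1 + N\<^sup>\<alpha> R\<^sup>2\<close> up to time \<open>N\<delta>\<close>, and \<open>P\<close> does not grow
  until \<open>Z\<close> falls below its past minimum, which by the sign of \<open>z\<close> happens near \<open>N t\<^sup>*\<close>.\<close>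

section \<open>Product measures and vanishing hyperedges\<close>

lemma measure_pair_pmf_Times:
  "measure_pmf.prob (pair_pmf M N) (A \<times> B) = measure_pmf.prob M A * measure_pmf.prob N B"
proof -
  have "measure_pmf.prob (pair_pmf M N) (A \<times> B)
      = measure_pmf.prob (pair_pmf M N) ((A \<inter> set_pmf M) \<times> (B \<inter> set_pmf N))"
    by (subst measure_Int_set_pmf [symmetric]) (simp add: Times_Int_Times)
  also have "\<dots> = measure_pmf.prob M (A \<inter> set_pmf M) * measure_pmf.prob N (B \<inter> set_pmf N)"
    by (intro measure_pmf_prob_product countable_Int2 countable_set_pmf)
  finally show ?thesis by (simp add: measure_Int_set_pmf)
qed

text \<open>\<open>Q\<close> is decided by the coordinates outside \<open>S\<close>, which under the
  product measure are independent of those in \<open>S\<close>.\<close>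

lemma prob_Pi_pmf_vanish:
  fixes p :: "'a \<Rightarrow> nat pmf"
  assumes fin: "finite A" and sub: "S \<subseteq> A"
    and Q: "\<And>H H'. (\<And>E. E \<in> A - S \<Longrightarrow> H E = H' E) \<Longrightarrow> Q H \<longleftrightarrow> Q H'"
  shows "measure_pmf.prob (Pi_pmf A 0 p) {H. Q H \<and> (\<forall>E\<in>S. H E = 0)}
       = measure_pmf.prob (Pi_pmf A 0 p) {H. Q H} * (\<Prod>E\<in>S. pmf (p E) 0)"
proof -
  let ?h = "\<lambda>(f, g) x. if x \<in> S then f x else g x :: nat"
  let ?S = "Pi_pmf S 0 p" and ?R = "Pi_pmf (A - S) 0 p"
  have fS: "finite S" using fin sub finite_subset by blast
  have dec: "Pi_pmf A 0 p = map_pmf ?h (pair_pmf ?S ?R)"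
    using Pi_pmf_union [of S "A - S" 0 p] fin fS sub by (simp add: Un_absorb1)
  have Qh: "Q (?h (f, g)) \<longleftrightarrow> Q g" for f g
    by (rule Q) auto
  have Qh': "Q (\<lambda>x. if x \<in> S then f x else g x) \<longleftrightarrow> Q g" for f g
    using Qh by simp
  have "?h -` {H. Q H \<and> (\<forall>E\<in>S. H E = 0)} = {f. \<forall>E\<in>S. f E = 0} \<times> {g. Q g}"
    by (auto simp: Qh')
  then have 1: "measure_pmf.prob (Pi_pmf A 0 p) {H. Q H \<and> (\<forall>E\<in>S. H E = 0)}
     = measure_pmf.prob ?S {f. \<forall>E\<in>S. f E = 0} * measure_pmf.prob ?R {g. Q g}"
    unfolding dec by (simp add: measure_pair_pmf_Times)
  have "?h -` {H. Q H} = UNIV \<times> {g. Q g}"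
    by (auto simp: Qh')
  then have 2: "measure_pmf.prob (Pi_pmf A 0 p) {H. Q H} = measure_pmf.prob ?R {g. Q g}"
    unfolding dec by (simp add: measure_pair_pmf_Times)
  have "{f. \<forall>E\<in>S. f E = 0} = Pi S (\<lambda>_. {0::nat})" by auto
  then have "measure_pmf.prob ?S {f. \<forall>E\<in>S. f E = 0} = (\<Prod>E\<in>S. pmf (p E) 0)"
    by (simp add: measure_Pi_pmf_Pi fS measure_pmf_single)
  with 1 2 show ?thesis by simp
qed

lemma pmf_poisson0_zero: "r \<ge> 0 \<Longrightarrow> pmf (poisson0_pmf r) 0 = exp (- r)"
  by (cases "r = 0") (auto simp: poisson0_pmf_def)

lemma finite_hedge_sets [simp]: "finite (hedge_sets N)"
  by (rule finite_subset [of _ "Pow {1..N}"]) (auto simp: hedge_sets_def)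

definition hedge_rate :: "(nat \<Rightarrow> real) \<Rightarrow> nat \<Rightarrow> nat set \<Rightarrow> real" where
  "hedge_rate \<beta> N A = real N * \<beta> (card A) / real (N choose card A)"

lemma hedge_rate_nonneg:
  assumes "\<forall>j\<ge>2. \<beta> j \<ge> 0" "A \<in> hedge_sets N"
  shows "hedge_rate \<beta> N A \<ge> 0"
  using assms by (auto simp: hedge_rate_def hedge_sets_def)

text \<open>The single place where the Poisson law enters: each absent hyperedge contributes the
  factor exp of minus its rate, whatever is known about the hyperedges outside
  \<open>S\<close>.\<close>

lemma prob_no_hyperedges:
  assumes \<beta>: "\<forall>j\<ge>2. \<beta> j \<ge> 0" and sub: "S \<subseteq> hedge_sets N"
    and Q: "\<And>H H'. (\<And>E. E \<in> hedge_sets N - S \<Longrightarrow> H E = H' E) \<Longrightarrow> Q H \<longleftrightarrow> Q H'"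
  shows "measure_pmf.prob (poisson_hypergraph \<beta> N) {H. Q H \<and> (\<forall>E\<in>S. H E = 0)}
       = measure_pmf.prob (poisson_hypergraph \<beta> N) {H. Q H} * exp (- (\<Sum>E\<in>S. hedge_rate \<beta> N E))"
proof -
  have fS: "finite S" using sub finite_subset finite_hedge_sets by blast
  have "(\<Prod>E\<in>S. pmf (poisson0_pmf (hedge_rate \<beta> N E)) 0) = (\<Prod>E\<in>S. exp (- hedge_rate \<beta> N E))"
    using sub by (intro prod.cong refl pmf_poisson0_zero hedge_rate_nonneg [OF \<beta>]) auto
  also have "\<dots> = exp (- (\<Sum>E\<in>S. hedge_rate \<beta> N E))"
    by (simp add: exp_sum fS flip: sum_negf)
  finally have eq: "(\<Prod>E\<in>S. pmf (poisson0_pmf (hedge_rate \<beta> N E)) 0)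
      = exp (- (\<Sum>E\<in>S. hedge_rate \<beta> N E))" .
  show ?thesis
    unfolding poisson_hypergraph_def
    using prob_Pi_pmf_vanish [OF finite_hedge_sets sub Q,
      where p = "\<lambda>A. poisson0_pmf (hedge_rate \<beta> N A)"] eq
    by (simp add: hedge_rate_def)
qed

section \<open>The breadth-first walk\<close>

lemma bfw_order_Suc:
  "bfw_order N H (Suc i) =
     (let vs' = bfw_order N H i @ bfw_children N H (bfw_order N H i) i; rest = {1..N} - set vs'
      in if length vs' \<le> Suc i \<and> rest \<noteq> {} then vs' @ [Min rest] else vs')"
  by (simp add: Let_def)

declare bfw_order.simps(2) [simp del]

lemma bfw_c_Suc: "bfw_c N H (Suc i) = length (bfw_children N H (bfw_order N H i) i)"
  by (simp add: bfw_c_def)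

text \<open>Lists count from 0: \<open>vs ! i\<close> is v(i + 1), and \<open>take i vs\<close>
  holds the deleted vertices. For an un-numbered \<open>w\<close> these are the hyperedges that the
  deletions have shrunk to the pair of \<open>vs ! i\<close> and \<open>w\<close>.\<close>

definition step_sets :: "nat \<Rightarrow> nat list \<Rightarrow> nat \<Rightarrow> nat \<Rightarrow> nat set set" where
  "step_sets N vs i w = {E \<in> hedge_sets N. vs ! i \<in> E \<and> w \<in> E \<and> E - {vs ! i, w} \<subseteq> set (take i vs)}"

lemma bfw_children_eq:
  "bfw_children N H vs i = (if i < length vs then
     sorted_list_of_set {w \<in> {1..N} - set vs. \<exists>E \<in> step_sets N vs i w. H E > 0} else [])"
  unfolding bfw_children_def step_sets_def
  by (intro if_cong arg_cong [where f = sorted_list_of_set]) auto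

lemma set_bfw_children:
  "set (bfw_children N H vs i) = (if i < length vs then
     {w \<in> {1..N} - set vs. \<exists>E \<in> step_sets N vs i w. H E > 0} else {})"
  by (simp add: bfw_children_eq)

lemma distinct_bfw_children: "distinct (bfw_children N H vs i)"
  by (simp add: bfw_children_def)

lemma bfw_order_wf:
  assumes "N \<ge> 1"
  shows "set (bfw_order N H i) \<subseteq> {1..N} \<and> distinct (bfw_order N H i)"
proof (induction i)
  case 0
  then show ?case using assms by simp
next
  case (Suc i)
  let ?vs' = "bfw_order N H i @ bfw_children N H (bfw_order N H i) i"
  have 1: "set ?vs' \<subseteq> {1..N}" "distinct ?vs'"
    using Suc by (auto simp: set_bfw_children distinct_bfw_children split: if_splits)
  have "Min ({1..N} - set ?vs') \<in> {1..N} - set ?vs'" if "{1..N} - set ?vs' \<noteq> {}"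
    using that by (intro Min_in) auto
  with 1 show ?case
    unfolding bfw_order_Suc Let_def by (auto split: if_splits)
qed

lemmas set_bfw_order = bfw_order_wf [THEN conjunct1]
lemmas distinct_bfw_order = bfw_order_wf [THEN conjunct2]

lemma length_bfw_order_le: "N \<ge> 1 \<Longrightarrow> length (bfw_order N H i) \<le> N"
  using card_mono [OF _ set_bfw_order, of N H i] distinct_bfw_order [of N H i]
  by (simp add: distinct_card)

lemma bfw_order_prefix: "l \<le> i \<Longrightarrow> \<exists>ys. bfw_order N H i = bfw_order N H l @ ys"
proof (induction i)
  case (Suc i)
  have "\<exists>ys. bfw_order N H (Suc i) = bfw_order N H i @ ys"
    unfolding bfw_order_Suc Let_def by auto
  with Suc show ?case by (cases "l = Suc i") auto
qed simp

section \<open>Counting patches and un-numbered vertices\<close>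

text \<open>Since \<open>bfw_Z N H i + i\<close> is the number of children found in \<open>i\<close>
  steps, the remaining numbered vertices are those that received a patch. The link to the past
  minimum of the walk is \<open>bfw_patches_le\<close>.\<close>

definition bfw_patches :: "nat \<Rightarrow> (nat set \<Rightarrow> nat) \<Rightarrow> nat \<Rightarrow> int" where
  "bfw_patches N H i = int (length (bfw_order N H i)) - int i - bfw_Z N H i"

lemma bfw_patches_0 [simp]: "bfw_patches N H 0 = 1"
  by (simp add: bfw_patches_def)

text \<open>The condition \<open>length vs' \<le> Suc i\<close> for placing a patch says that old
  patch count plus new value of \<open>bfw_Z\<close> is at most 0.\<close>

lemma bfw_patches_Suc:
  "bfw_patches N H (Suc i) = bfw_patches N H i \<or>
   bfw_patches N H (Suc i) = bfw_patches N H i + 1 \<and> bfw_patches N H (Suc i) \<le> 1 - bfw_Z N H (Suc i)"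
  by (auto simp: bfw_patches_def bfw_order_Suc Let_def bfw_c_Suc)

lemma bfw_patches_ge_1: "bfw_patches N H i \<ge> 1"
proof (induction i)
  case (Suc i)
  with bfw_patches_Suc [of N H i] show ?case by auto
qed simp

text \<open>The count can only rise to a level at most \<open>1 - bfw_Z\<close>, so it stays below 1
  minus any lower bound on the past of the walk.\<close>

lemma bfw_patches_le:
  "(\<And>j. j \<le> i \<Longrightarrow> bfw_Z N H j \<ge> - b) \<Longrightarrow> b \<ge> 0 \<Longrightarrow> bfw_patches N H i \<le> 1 + b"
proof (induction i)
  case (Suc i)
  from Suc.prems(1) [of "Suc i"] Suc.IH [OF Suc.prems(1) Suc.prems(2)] bfw_patches_Suc [of N H i]
  show ?case by auto
qed simp

text \<open>Ensures that there is a vertex to process in every step before \<open>N\<close>: if the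
  queue is empty, at most \<open>Suc i < N\<close> vertices are numbered and one is left for a
  patch.\<close>

lemma length_bfw_order_gt:
  assumes "N \<ge> 1" "i < N"
  shows "i < length (bfw_order N H i)"
  using assms(2)
proof (induction i)
  case (Suc i)
  let ?vs' = "bfw_order N H i @ bfw_children N H (bfw_order N H i) i"
  have IH: "i < length (bfw_order N H i)" using Suc by simp
  show ?case
  proof (cases "length ?vs' \<le> Suc i")
    case True
    have "{1..N} - set ?vs' \<noteq> {}"
    proof
      assume "{1..N} - set ?vs' = {}"
      then have "card {1..N} \<le> card (set ?vs')" by (intro card_mono) auto
      also have "\<dots> \<le> length ?vs'" by (rule card_length)
      finally show False using True Suc.prems by simp
    qed
    with True IH show ?thesis unfolding bfw_order_Suc Let_def by auto
  qed (auto simp: bfw_order_Suc Let_def)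
qed simp

lemma bfw_Z_N: "N \<ge> 1 \<Longrightarrow> bfw_Z N H N \<le> 0"
  using bfw_patches_ge_1 [of N H N] length_bfw_order_le [of N H N]
  by (simp add: bfw_patches_def)

lemma bfw_Z_Suc_ge: "bfw_Z N H (Suc i) \<ge> bfw_Z N H i - 1"
  by simp

lemma bfw_Z_ge: "bfw_Z N H i \<ge> - int i"
  by (induction i) auto

definition bfw_unnumbered :: "nat \<Rightarrow> (nat set \<Rightarrow> nat) \<Rightarrow> nat \<Rightarrow> real" where
  "bfw_unnumbered N H i = real N - real (length (bfw_order N H i))"

lemma bfw_unnumbered_eq:
  "bfw_unnumbered N H i = real N - real i - of_int (bfw_Z N H i) - of_int (bfw_patches N H i)"
  by (simp add: bfw_unnumbered_def bfw_patches_def)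

lemma bfw_unnumbered_nonneg: "N \<ge> 1 \<Longrightarrow> bfw_unnumbered N H i \<ge> 0"
  using length_bfw_order_le by (simp add: bfw_unnumbered_def)

lemma bfw_unnumbered_Suc:
  "bfw_unnumbered N H (Suc i) = bfw_unnumbered N H i - real (bfw_c N H (Suc i))
     - of_int (bfw_patches N H (Suc i) - bfw_patches N H i)"
  by (simp add: bfw_unnumbered_eq)

text \<open>With \<open>q\<close> the survival probabilities, this is the number of un-numbered vertices plus, for each
  vertex numbered through a patch, the product of the \<open>q l\<close> over the steps \<open>l\<close> since then.\<close>

fun bfw_K :: "(nat \<Rightarrow> real) \<Rightarrow> nat \<Rightarrow> (nat set \<Rightarrow> nat) \<Rightarrow> nat \<Rightarrow> real" where
  "bfw_K q N H 0 = real N"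
| "bfw_K q N H (Suc i) = q i * bfw_K q N H i + (1 - q i) * bfw_unnumbered N H i - real (bfw_c N H (Suc i))"

text \<open>The difference \<open>d\<close> of \<open>bfw_K\<close> and
  \<open>bfw_unnumbered\<close> evolves by \<open>d \<mapsto> q i * d + e\<close>, where
  \<open>e\<close> is the number of new patches.\<close>

lemma bfw_K_bounds:
  assumes q: "\<And>i. 0 \<le> q i" "\<And>i. q i \<le> 1"
  shows "bfw_unnumbered N H i \<le> bfw_K q N H i \<and>
    bfw_K q N H i \<le> bfw_unnumbered N H i + of_int (bfw_patches N H i)"
proof (induction i)
  case 0
  then show ?case by (simp add: bfw_unnumbered_eq)
next
  case (Suc i)
  let ?d = "bfw_K q N H i - bfw_unnumbered N H i"
  let ?e = "of_int (bfw_patches N H (Suc i) - bfw_patches N H i) :: real"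
  have e: "?e \<ge> 0" using bfw_patches_Suc [of N H i] by auto
  have d: "0 \<le> ?d" "?d \<le> of_int (bfw_patches N H i)" using Suc by auto
  have eq: "bfw_K q N H (Suc i) - bfw_unnumbered N H (Suc i) = q i * ?d + ?e"
    by (simp add: bfw_unnumbered_Suc algebra_simps)
  have "q i * ?d \<le> ?d" "0 \<le> q i * ?d" using d q [of i] by (auto intro: mult_left_le_one_le)
  with eq e d show ?case by auto
qed

text \<open>One step lowers \<open>bfw_K\<close> by
  \<open>(1 - q i) * (bfw_K - bfw_unnumbered)\<close> plus the number of children, both nonnegative.
  This later allows interpolation between grid points.\<close>

lemma bfw_K_antimono:
  assumes q: "\<And>i. 0 \<le> q i" "\<And>i. q i \<le> 1" and "i \<le> j"
  shows "bfw_K q N H j \<le> bfw_K q N H i"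
proof -
  have "bfw_K q N H (Suc i) \<le> bfw_K q N H i" for i
  proof -
    have "(1 - q i) * bfw_unnumbered N H i \<le> (1 - q i) * bfw_K q N H i"
      using bfw_K_bounds [of q, OF q] q by (intro mult_left_mono) auto
    then show ?thesis by (simp add: algebra_simps)
  qed
  then show ?thesis using \<open>i \<le> j\<close> by (rule lift_Suc_antimono_le)
qed

text \<open>Finding \<open>v(1), \<dots>, v(i)\<close> and their children only uses hyperedges with at most one
  vertex outside \<open>{v(1), \<dots>, v(i)}\<close>.\<close>

lemma bfw_local:
  assumes N: "N \<ge> 1"
    and agree: "\<And>E. E \<in> hedge_sets N \<Longrightarrow> card (E - set (take i (bfw_order N H i))) \<le> 1 \<Longrightarrow>
      H E > 0 \<longleftrightarrow> H' E > 0"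
    and "l \<le> i"
  shows "bfw_order N H' l = bfw_order N H l \<and> bfw_K q N H' l = bfw_K q N H l"
  using \<open>l \<le> i\<close>
proof (induction l)
  case (Suc l)
  let ?vs = "bfw_order N H l"
  have IH: "bfw_order N H' l = ?vs" "bfw_K q N H' l = bfw_K q N H l" using Suc by auto
  have "H E > 0 \<longleftrightarrow> H' E > 0" if l: "l < length ?vs" and E: "E \<in> step_sets N ?vs l w" for E w
  proof (rule agree)
    show "E \<in> hedge_sets N" using E by (simp add: step_sets_def)
    \<comment> \<open>The order at time \<open>l\<close> is a prefix of that at time
      \<open>i\<close>, so the first \<open>l + 1\<close> vertices are the same and lie among the
      first \<open>i\<close>; only \<open>w\<close> can be outside.\<close>
    obtain ys where ys: "bfw_order N H i = ?vs @ ys" using bfw_order_prefix [of l i N H] Suc by auto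
    have "take (Suc l) ?vs = take (Suc l) (bfw_order N H i)" using l ys by simp
    then have "set (take (Suc l) ?vs) \<subseteq> set (take i (bfw_order N H i))"
      using Suc.prems set_take_subset_set_take by metis
    moreover have "E \<subseteq> insert w (set (take (Suc l) ?vs))"
      using E l by (auto simp: step_sets_def take_Suc_conv_app_nth)
    ultimately have "E - set (take i (bfw_order N H i)) \<subseteq> {w}" by auto
    from card_mono [OF _ this] show "card (E - set (take i (bfw_order N H i))) \<le> 1" by simp
  qed
  then have "bfw_children N H' ?vs l = bfw_children N H ?vs l"
    unfolding bfw_children_eq
    by (intro if_cong arg_cong [where f = sorted_list_of_set]) auto
  with IH show ?case
    by (simp add: bfw_order_Suc bfw_c_Suc bfw_unnumbered_def)
qed simp

text \<open>Multiplicities do not influence the walk. With \<open>finite_range_positivity\<close>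
  this gives finitely many values, hence integrability.\<close>

lemma bfw_local_positivity:
  assumes N: "N \<ge> 1" and agree: "\<And>E. E \<in> hedge_sets N \<Longrightarrow> H E > 0 \<longleftrightarrow> H' E > 0"
  shows "bfw_order N H' i = bfw_order N H i" "bfw_K q N H' i = bfw_K q N H i"
  using bfw_local [OF N agree order_refl, where q = q] by simp_all

section \<open>Second moment of the deviation\<close>

text \<open>The total rate of hyperedges that join two given undeleted vertices and otherwise
  consist of deleted ones; \<open>c\<close> is the number of the latter, so the original size is
  \<open>c + 2\<close>.\<close>

definition step_rate :: "(nat \<Rightarrow> real) \<Rightarrow> nat \<Rightarrow> nat \<Rightarrow> real" where
  "step_rate \<beta> N i = (\<Sum>c\<le>i. real (i choose c) * (real N * \<beta> (c + 2) / real (N choose (c + 2))))"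

lemma sum_card_Pow:
  fixes f :: "nat \<Rightarrow> real"
  assumes "finite T"
  shows "(\<Sum>C\<in>Pow T. f (card C)) = (\<Sum>c\<le>card T. real (card T choose c) * f c)"
proof -
  have "(\<Sum>C\<in>Pow T. f (card C)) = (\<Sum>c\<le>card T. \<Sum>C | C \<in> Pow T \<and> card C = c. f (card C))"
    using assms by (intro sum.group [symmetric]) (auto intro: card_mono)
  also have "\<dots> = (\<Sum>c\<le>card T. real (card T choose c) * f c)"
    using assms by (intro sum.cong refl) (simp add: n_subsets)
  finally show ?thesis .
qed

text \<open>A hyperedge of the step set is determined by its deleted part, an arbitrary subset of
  the \<open>i\<close> deleted vertices. Hence the total depends neither on \<open>w\<close> nor on
  the history \<open>vs\<close>.\<close>

lemma sum_hedge_rate_step_sets: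
  assumes vs: "set vs \<subseteq> {1..N}" "distinct vs" "i < length vs" and w: "w \<in> {1..N} - set vs"
  shows "(\<Sum>E\<in>step_sets N vs i w. hedge_rate \<beta> N E) = step_rate \<beta> N i"
proof -
  let ?T = "set (take i vs)" and ?v = "vs ! i"
  let ?g = "\<lambda>C. insert ?v (insert w C)"
  have TV: "?T \<subseteq> set vs" by (rule set_take_subset)
  have v: "?v \<in> set vs" using vs by simp
  have vT: "?v \<notin> ?T"
    using vs by (auto simp: in_set_conv_nth nth_eq_iff_index_eq)
  have wT: "w \<notin> ?T" "w \<noteq> ?v" using w TV v by auto
  have card_T: "card ?T = i" using vs by (simp add: distinct_card)
  have card_g: "card (?g C) = card C + 2" if "C \<in> Pow ?T" for C
  proof -
    have "finite C" using that finite_subset by auto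
    moreover have "?v \<notin> C" "w \<notin> C" using that vT wT by auto
    ultimately show ?thesis using wT by simp
  qed
  have img: "step_sets N vs i w = ?g ` Pow ?T"
  proof (intro equalityI subsetI)
    fix E assume E: "E \<in> step_sets N vs i w"
    then have "E = ?g (E - {?v, w})" "E - {?v, w} \<in> Pow ?T" by (auto simp: step_sets_def)
    then show "E \<in> ?g ` Pow ?T" by blast
  next
    fix E assume "E \<in> ?g ` Pow ?T"
    then obtain C where C: "C \<in> Pow ?T" "E = ?g C" by blast
    have "?v \<in> {1..N}" using v vs by blast
    then have "E \<subseteq> {1..N}" using C vs(1) w TV by auto
    moreover have "card E \<ge> 2" using card_g C by simp
    ultimately show "E \<in> step_sets N vs i w"
      using C by (auto simp: step_sets_def hedge_sets_def)
  qed
  have inj: "inj_on ?g (Pow ?T)"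
    by (rule inj_on_inverseI [where g = "\<lambda>E. E - {?v, w}"]) (use vT wT in auto)
  have "(\<Sum>E\<in>step_sets N vs i w. hedge_rate \<beta> N E)
      = (\<Sum>C\<in>Pow ?T. real N * \<beta> (card C + 2) / real (N choose (card C + 2)))"
    unfolding img by (subst sum.reindex [OF inj], intro sum.cong refl)
      (simp only: hedge_rate_def card_g comp_apply)
  also have "\<dots> = step_rate \<beta> N i"
    by (subst sum_card_Pow) (simp_all add: card_T step_rate_def)
  finally show ?thesis .
qed

text \<open>Two consequences are drawn: the step sets of different \<open>w\<close> are disjoint,
  and, having two vertices outside, none of their members has been inspected before.\<close>

lemma step_sets_minus:
  assumes "distinct vs" "i < length vs" "w \<notin> set vs" "E \<in> step_sets N vs i w"
  shows "E - set (take i vs) = {vs ! i, w}"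
proof -
  have "vs ! i \<notin> set (take i vs)"
    using assms by (auto simp: in_set_conv_nth nth_eq_iff_index_eq)
  moreover have "w \<notin> set (take i vs)" using assms set_take_subset by fast
  ultimately show ?thesis using assms by (auto simp: step_sets_def)
qed

definition survival :: "(nat \<Rightarrow> real) \<Rightarrow> nat \<Rightarrow> nat \<Rightarrow> real" where
  "survival \<beta> N i = exp (- step_rate \<beta> N i)"

definition bfw_dev :: "(nat \<Rightarrow> real) \<Rightarrow> nat \<Rightarrow> (nat set \<Rightarrow> nat) \<Rightarrow> nat \<Rightarrow> real" where
  "bfw_dev \<beta> N H i = bfw_K (survival \<beta> N) N H i - real N * (\<Prod>l<i. survival \<beta> N l)"

lemma step_rate_nonneg: "\<forall>j\<ge>2. \<beta> j \<ge> 0 \<Longrightarrow> step_rate \<beta> N i \<ge> 0"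
  by (simp add: step_rate_def sum_nonneg)

lemma survival_bounds:
  assumes "\<forall>j\<ge>2. \<beta> j \<ge> 0" shows "0 \<le> survival \<beta> N i" "survival \<beta> N i \<le> 1"
  using step_rate_nonneg [OF assms] by (simp_all add: survival_def)

text \<open>A step with survival probability \<open>p\<close> adds the variance \<open>U p (1 - p)\<close> to the second moment,
  while the number \<open>U\<close> of un-numbered vertices loses at least \<open>U (1 - p)\<close> on average; the sum
  therefore cannot grow.\<close>

lemma expectation_step:
  fixes \<kappa> :: real and vs :: "nat list"
  assumes \<beta>: "\<forall>j\<ge>2. \<beta> j \<ge> 0" and N: "i < N"
  defines "\<mu> \<equiv> poisson_hypergraph \<beta> N"
  defines "Q \<equiv> \<lambda>H. bfw_order N H i = vs \<and> bfw_K (survival \<beta> N) N H i = \<kappa>"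
  shows "measure_pmf.expectation \<mu>
      (\<lambda>H. indicator {H. Q H} H * ((bfw_dev \<beta> N H (Suc i))\<^sup>2 + bfw_unnumbered N H (Suc i)))
    \<le> measure_pmf.expectation \<mu>
      (\<lambda>H. indicator {H. Q H} H * ((bfw_dev \<beta> N H i)\<^sup>2 + bfw_unnumbered N H i))"
    (is "?L \<le> ?R")
proof (cases "\<exists>H. Q H")
  case False
  then show ?thesis by simp
next
  case True
  then obtain H0 where H0: "Q H0" by blast
  have N1: "N \<ge> 1" using N by simp
  have vs: "set vs \<subseteq> {1..N}" "distinct vs" "i < length vs"
    using H0 bfw_order_wf [OF N1] length_bfw_order_gt [OF N1 N] by (auto simp: Q_def)
  define rest where "rest = {1..N} - set vs"
  define u where "u = real (card rest)"
  define S where "S = step_sets N vs i"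
  define p where "p = survival \<beta> N i"
  define \<omega> where "\<omega> = \<kappa> - real N * (\<Prod>l<i. survival \<beta> N l)"
  \<comment> \<open>Chosen such that on \<open>Q\<close> the next deviation is
    \<open>A + X H\<close>, with \<open>X H\<close> the number of vertices of \<open>rest\<close>
    that survive. As \<open>X\<close> has conditional mean \<open>p * u\<close>, the new mean
    deviation is \<open>p * \<omega>\<close>.\<close>
  define A where "A = p * \<omega> - p * u"
  define q where "q = measure_pmf.prob \<mu> {H. Q H}"
  \<comment> \<open>Survival of one vertex and of two vertices, which is enough for the first two
    moments of \<open>X\<close>.\<close>
  define J1 where "J1 w = {H. Q H \<and> (\<forall>E\<in>S w. H E = 0)}" for w
  define J2 where "J2 w w' = {H. Q H \<and> (\<forall>E\<in>S w \<union> S w'. H E = 0)}" for w w'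
  have p: "0 \<le> p" "p \<le> 1" using survival_bounds [OF \<beta>] by (auto simp: p_def)
  have fin: "finite rest" by (simp add: rest_def)
  have u_eq: "u = real N - real (length vs)"
    using vs card_mono [OF _ vs(1)]
    by (simp add: u_def rest_def card_Diff_subset distinct_card)
  have S_sub: "S w \<subseteq> hedge_sets N" for w by (auto simp: S_def step_sets_def)
  have fS: "finite (S w)" for w using S_sub finite_subset finite_hedge_sets by blast
  have S_minus: "E - set (take i vs) = {vs ! i, w}" if "w \<in> rest" "E \<in> S w" for w E
    using step_sets_minus [of vs i w E N] vs that by (auto simp: rest_def S_def)
  have v_ne: "vs ! i \<noteq> w" if "w \<in> rest" for w
    using that vs by (auto simp: rest_def)
  have S_disj: "S w \<inter> S w' = {}" if "w \<in> rest" "w' \<in> rest" "w \<noteq> w'" for w w'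
  proof (rule equals0I)
    fix E assume "E \<in> S w \<inter> S w'"
    then have "{vs ! i, w} = {vs ! i, w'}" using S_minus that by (metis IntD1 IntD2)
    then show False using that v_ne [of w] v_ne [of w'] by (auto simp: doubleton_eq_iff)
  qed
  \<comment> \<open>By \<open>bfw_local\<close>, \<open>Q\<close> is decided by hyperedges with at
    most one vertex outside \<open>take i vs\<close>; those in the sets \<open>S w\<close> have
    two.\<close>
  have Q_local: "Q H \<longleftrightarrow> Q H'"
    if T: "T \<subseteq> (\<Union>w\<in>rest. S w)" and ag: "\<And>E. E \<in> hedge_sets N - T \<Longrightarrow> H E = H' E" for T H H'
  proof -
    have "Q G \<Longrightarrow> Q G'" if ag: "\<And>E. E \<in> hedge_sets N - T \<Longrightarrow> G E = G' E" for G G'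
    proof -
      assume G: "Q G"
      have pos: "(G E > 0) = (G' E > 0)"
        if E: "E \<in> hedge_sets N" "card (E - set (take i (bfw_order N G i))) \<le> 1" for E
      proof -
        have "E \<notin> T"
        proof
          assume "E \<in> T"
          then obtain w where "w \<in> rest" "E \<in> S w" using T by blast
          then have "card (E - set (take i vs)) = 2" using S_minus v_ne by simp
          then show False using E G by (simp add: Q_def)
        qed
        then show ?thesis using ag E by auto
      qed
      from bfw_local [where H = G and H' = G' and i = i and l = i and q = "survival \<beta> N", OF N1 pos order_refl]
      show "Q G'"
        using G by (simp add: Q_def)
    qed
    from this [of H H'] this [of H' H] ag show ?thesis by auto
  qed
  have rate: "(\<Sum>E\<in>S w. hedge_rate \<beta> N E) = step_rate \<beta> N i" if "w \<in> rest" for w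
    using that sum_hedge_rate_step_sets [OF vs] by (simp add: rest_def S_def)
  have J1: "measure_pmf.prob \<mu> (J1 w) = q * p" if w: "w \<in> rest" for w
    unfolding J1_def q_def \<mu>_def
    by (subst prob_no_hyperedges [OF \<beta> S_sub Q_local])
       (use w in \<open>auto simp: rate p_def survival_def\<close>)
  have J2: "measure_pmf.prob \<mu> (J2 w w') = (if w = w' then q * p else q * p\<^sup>2)"
    if w: "w \<in> rest" "w' \<in> rest" for w w'
  proof (cases "w = w'")
    case True
    then have "J2 w w' = J1 w" by (simp add: J1_def J2_def)
    then show ?thesis using J1 w True by simp
  next
    case False
    have "(\<Sum>E\<in>S w \<union> S w'. hedge_rate \<beta> N E) = 2 * step_rate \<beta> N i"
      using rate w by (simp add: sum.union_disjoint fS S_disj [OF w False])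
    moreover have "measure_pmf.prob \<mu> (J2 w w') = q * exp (- (\<Sum>E\<in>S w \<union> S w'. hedge_rate \<beta> N E))"
      unfolding J2_def q_def \<mu>_def
      by (rule prob_no_hyperedges [OF \<beta> _ Q_local [of "S w \<union> S w'"]])
         (use w S_sub in auto)
    ultimately show ?thesis using False
      by (simp add: p_def survival_def power2_eq_square flip: exp_add)
  qed
  define X where "X H = (\<Sum>w\<in>rest. indicator {H. \<forall>E\<in>S w. H E = 0} H :: real)" for H :: "nat set \<Rightarrow> nat"
  have X: "X H = u - real (bfw_c N H (Suc i))" if "Q H" for H
  proof -
    have ord: "bfw_order N H i = vs" using that by (simp add: Q_def)
    let ?C = "{w \<in> rest. \<exists>E \<in> S w. H E > 0}"
    have "real (bfw_c N H (Suc i)) = real (card ?C)"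
      using vs unfolding bfw_c_Suc ord bfw_children_eq by (simp add: rest_def S_def)
    moreover have "X H = real (card {w \<in> rest. \<forall>E\<in>S w. H E = 0})"
      using fin by (simp add: X_def indicator_def sum.If_cases Int_def)
    moreover have "card rest = card ?C + card {w \<in> rest. \<forall>E\<in>S w. H E = 0}"
      using fin by (subst card_Un_disjoint [symmetric]) (auto intro!: arg_cong [where f = card])
    ultimately show ?thesis by (simp add: u_def)
  qed
  \<comment> \<open>An inequality because a patch placed at the end of the step removes a further
    un-numbered vertex.\<close>
  have step: "(bfw_dev \<beta> N H (Suc i))\<^sup>2 + bfw_unnumbered N H (Suc i) \<le> (A + X H)\<^sup>2 + X H"
    if "Q H" for H
  proof -
    have un: "bfw_unnumbered N H i = u" using that by (simp add: bfw_unnumbered_def Q_def u_eq)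
    have K: "bfw_K (survival \<beta> N) N H i = \<kappa>" using that by (simp add: Q_def)
    have "bfw_dev \<beta> N H (Suc i) = A + X H"
      unfolding bfw_dev_def bfw_K.simps K un X [OF that] A_def \<omega>_def p_def
      by (simp add: algebra_simps)
    moreover have "bfw_unnumbered N H (Suc i) \<le> X H"
      using bfw_patches_Suc [of N H i] X [OF that] un by (auto simp: bfw_unnumbered_Suc)
    ultimately show ?thesis by simp
  qed
  \<comment> \<open>The expansion of \<open>(A + X)\<^sup>2 + X\<close> on \<open>Q\<close>, with
    \<open>X\<close> and its square written as sums of indicators of survival events.\<close>
  define F where "F H = A\<^sup>2 * indicator {H. Q H} H + (2 * A + 1) * (\<Sum>w\<in>rest. indicator (J1 w) H)
    + (\<Sum>w\<in>rest. \<Sum>w'\<in>rest. indicator (J2 w w') H :: real)" for H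
  have F_eq: "F H = indicator {H. Q H} H * ((A + X H)\<^sup>2 + X H)" for H
  proof (cases "Q H")
    case True
    have a: "(\<Sum>w\<in>rest. indicator (J1 w) H) = X H"
      using True by (simp add: J1_def X_def indicator_def)
    have "(\<Sum>w\<in>rest. \<Sum>w'\<in>rest. indicator (J2 w w') H) = X H * X H"
      unfolding X_def sum_product using True
      by (intro sum.cong refl) (auto simp: J2_def indicator_def)
    with a True show ?thesis by (simp add: F_def power2_eq_square algebra_simps)
  qed (simp add: F_def J1_def J2_def)
  have EF: "measure_pmf.expectation \<mu> F = A\<^sup>2 * q + (2 * A + 1) * (u * (q * p))
     + (\<Sum>w\<in>rest. \<Sum>w'\<in>rest. (if w = w' then q * p else q * p\<^sup>2))"
  proof -
    have "measure_pmf.expectation \<mu> F = A\<^sup>2 * measure_pmf.prob \<mu> {H. Q H}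
       + (2 * A + 1) * (\<Sum>w\<in>rest. measure_pmf.prob \<mu> (J1 w))
       + (\<Sum>w\<in>rest. \<Sum>w'\<in>rest. measure_pmf.prob \<mu> (J2 w w'))"
      unfolding F_def by (simp add: measure_pmf.emeasure_eq_measure)
    then show ?thesis by (simp add: J1 J2 q_def u_def)
  qed
  have "(\<Sum>w'\<in>rest. (if w = w' then q * p else q * p\<^sup>2)) = q * p + (u - 1) * (q * p\<^sup>2)"
    if "w \<in> rest" for w
  proof -
    have "(\<Sum>w'\<in>rest. (if w = w' then q * p else q * p\<^sup>2))
      = (\<Sum>w'\<in>rest. q * p\<^sup>2 + (if w = w' then q * p - q * p\<^sup>2 else 0))"
      by (intro sum.cong) auto
    also have "\<dots> = q * p + (u - 1) * (q * p\<^sup>2)"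
      using that fin by (simp add: sum.distrib u_def algebra_simps)
    finally show ?thesis .
  qed
  then have "(\<Sum>w\<in>rest. \<Sum>w'\<in>rest. (if w = w' then q * p else q * p\<^sup>2))
      = u * (q * p + (u - 1) * (q * p\<^sup>2))"
    by (simp add: u_def)
  \<comment> \<open>Squared mean \<open>p\<^sup>2 * \<omega>\<^sup>2\<close>, plus variance
    \<open>u * p * (1 - p)\<close>, plus the mean number \<open>u * p\<close> of survivors.\<close>
  with EF have EF': "measure_pmf.expectation \<mu> F
      = q * (p\<^sup>2 * \<omega>\<^sup>2 + (u * (2 * p - p\<^sup>2)))"
    by (simp add: A_def power2_eq_square algebra_simps)
  have "?L \<le> measure_pmf.expectation \<mu> F"
  proof (rule integral_mono_AE')
    show "integrable (measure_pmf \<mu>) F"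
      unfolding F_def by (simp add: measure_pmf.emeasure_eq_measure)
    show "AE H in measure_pmf \<mu>. indicator {H. Q H} H *
       ((bfw_dev \<beta> N H (Suc i))\<^sup>2 + bfw_unnumbered N H (Suc i)) \<le> F H"
      using step by (intro AE_I2) (auto simp: F_eq indicator_def)
    show "AE H in measure_pmf \<mu>. 0 \<le> F H"
      by (intro AE_I2) (auto simp: F_eq X_def indicator_def intro!: add_nonneg_nonneg sum_nonneg)
  qed
  also have "\<dots> \<le> q * (\<omega>\<^sup>2 + u)"
  proof -
    have "p\<^sup>2 * \<omega>\<^sup>2 \<le> \<omega>\<^sup>2" using p by (simp add: power_le_one mult_left_le_one_le)
    moreover have "u * (2 * p - p\<^sup>2) \<le> u"
    proof -
      have "2 * p - p\<^sup>2 = 1 - (1 - p)\<^sup>2" by (simp add: power2_eq_square algebra_simps)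
      then have "2 * p - p\<^sup>2 \<le> 1" by simp
      then show ?thesis using mult_left_le [of "2 * p - p\<^sup>2" u] by (simp add: u_def)
    qed
    ultimately show ?thesis
      unfolding EF' q_def by (intro mult_left_mono add_mono) auto
  qed
  also have "\<dots> = ?R"
  proof -
    have "indicator {H. Q H} H * ((bfw_dev \<beta> N H i)\<^sup>2 + bfw_unnumbered N H i)
       = indicator {H. Q H} H * (\<omega>\<^sup>2 + u)" for H
      by (auto simp: indicator_def Q_def bfw_dev_def bfw_unnumbered_def \<omega>_def u_eq)
    then have "?R = measure_pmf.expectation \<mu> (\<lambda>H. indicator {H. Q H} H * (\<omega>\<^sup>2 + u))"
      by (simp only:)
    then show ?thesis by (simp add: q_def)
  qed
  finally show ?thesis .
qed

section \<open>From one step to the whole walk\<close>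

lemma integrable_measure_pmf_finite_range:
  fixes f :: "'a \<Rightarrow> real"
  assumes "finite (range f)"
  shows "integrable (measure_pmf M) f"
proof -
  obtain B where "\<And>x. \<bar>f x\<bar> \<le> B"
    using assms finite_imp_bounded [OF assms] by (auto simp: bounded_real)
  then show ?thesis
    by (intro measure_pmf.integrable_const_bound [where B = B]) auto
qed

text \<open>\<open>f\<close> factors through the set of present hyperedges, each such set being
  represented by multiplicities 0 and 1.\<close>

lemma finite_range_positivity:
  assumes "\<And>H H'. (\<And>E. E \<in> hedge_sets N \<Longrightarrow> H E > 0 \<longleftrightarrow> H' E > (0::nat)) \<Longrightarrow> f H = f H'"
  shows "finite (range f)"
proof (rule finite_surj [of "Pow (hedge_sets N)"])
  show "range f \<subseteq> (\<lambda>S. f (\<lambda>E. of_bool (E \<in> S))) ` Pow (hedge_sets N)"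
  proof
    fix y assume "y \<in> range f"
    then obtain H where H: "y = f H" by blast
    let ?S = "{E \<in> hedge_sets N. H E > 0}"
    have "f H = f (\<lambda>E. of_bool (E \<in> ?S))" by (rule assms) auto
    with H show "y \<in> (\<lambda>S. f (\<lambda>E. of_bool (E \<in> S))) ` Pow (hedge_sets N)"
      by blast
  qed
qed simp

text \<open>Sums \<open>expectation_step\<close> over the finitely many values of the pair
  \<open>st\<close> of order and \<open>bfw_K\<close>.\<close>

lemma expectation_dev_Suc:
  assumes \<beta>: "\<forall>j\<ge>2. \<beta> j \<ge> 0" and N: "i < N"
  defines "F \<equiv> \<lambda>i H. (bfw_dev \<beta> N H i)\<^sup>2 + bfw_unnumbered N H i"
  shows "measure_pmf.expectation (poisson_hypergraph \<beta> N) (F (Suc i))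
    \<le> measure_pmf.expectation (poisson_hypergraph \<beta> N) (F i)"
proof -
  let ?\<mu> = "poisson_hypergraph \<beta> N"
  have N1: "N \<ge> 1" using N by simp
  define st where "st H = (bfw_order N H i, bfw_K (survival \<beta> N) N H i)" for H
  have loc: "bfw_order N H i = bfw_order N H' i"
     "bfw_K (survival \<beta> N) N H i = bfw_K (survival \<beta> N) N H' i"
    if "\<And>E. E \<in> hedge_sets N \<Longrightarrow> H E > 0 \<longleftrightarrow> H' E > 0" for H H' i
    using bfw_local_positivity [OF N1 that] by simp_all
  have fin: "finite (range st)"
  proof (rule finite_range_positivity [of N])
    fix H H' :: "nat set \<Rightarrow> nat" assume ag: "\<And>E. E \<in> hedge_sets N \<Longrightarrow> H E > 0 \<longleftrightarrow> H' E > 0"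
    show "st H = st H'" by (simp only: st_def loc(1) [OF ag] loc(2) [OF ag])
  qed
  have "finite (range (F j))" for j
  proof (rule finite_range_positivity [of N])
    fix H H' :: "nat set \<Rightarrow> nat" assume ag: "\<And>E. E \<in> hedge_sets N \<Longrightarrow> H E > 0 \<longleftrightarrow> H' E > 0"
    show "F j H = F j H'"
      by (simp only: F_def bfw_dev_def bfw_unnumbered_def loc(1) [OF ag] loc(2) [OF ag])
  qed
  then have int: "integrable (measure_pmf ?\<mu>) (F j)" for j
    by (rule integrable_measure_pmf_finite_range)
  have split: "measure_pmf.expectation ?\<mu> (F j)
     = (\<Sum>s\<in>range st. measure_pmf.expectation ?\<mu> (\<lambda>H. indicator {H. st H = s} H * F j H))" for j
  proof -
    have "F j H = (\<Sum>s\<in>range st. indicator {H. st H = s} H * F j H)" for H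
    proof -
      have "(\<Sum>s\<in>range st. indicator {H. st H = s} H * F j H) = (\<Sum>s\<in>range st. if s = st H then F j H else 0)"
        by (intro sum.cong) (auto simp: indicator_def)
      then show ?thesis using fin by simp
    qed
    then have "measure_pmf.expectation ?\<mu> (F j)
      = measure_pmf.expectation ?\<mu> (\<lambda>H. \<Sum>s\<in>range st. indicator {H. st H = s} H * F j H)"
      by simp
    also have "\<dots> = (\<Sum>s\<in>range st. measure_pmf.expectation ?\<mu> (\<lambda>H. indicator {H. st H = s} H * F j H))"
      using integrable_mult_indicator [OF _ int]
      by (intro Bochner_Integration.integral_sum) simp
    finally show ?thesis .
  qed
  show ?thesis unfolding split
  proof (rule sum_mono)
    fix s assume "s \<in> range st"
    obtain vs \<kappa> where s: "s = (vs, \<kappa>)" by (cases s)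
    show "measure_pmf.expectation ?\<mu> (\<lambda>H. indicator {H. st H = s} H * F (Suc i) H)
      \<le> measure_pmf.expectation ?\<mu> (\<lambda>H. indicator {H. st H = s} H * F i H)"
      using expectation_step [OF \<beta> N, of vs \<kappa>] by (simp add: s st_def F_def)
  qed
qed

text \<open>Initially the deviation is 0 and \<open>N - 1\<close> vertices are un-numbered, so the
  non-increasing expectation stays below \<open>N\<close>; the bound follows by Markov's inequality
  for the square.\<close>

lemma prob_dev_ge:
  assumes \<beta>: "\<forall>j\<ge>2. \<beta> j \<ge> 0" and N: "i \<le> N" "N \<ge> 1" and e: "e > 0"
  shows "measure_pmf.prob (poisson_hypergraph \<beta> N) {H. \<bar>bfw_dev \<beta> N H i\<bar> \<ge> e * real N}
    \<le> 1 / (e\<^sup>2 * real N)"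
proof -
  let ?\<mu> = "poisson_hypergraph \<beta> N"
  define F where "F i H = (bfw_dev \<beta> N H i)\<^sup>2 + bfw_unnumbered N H i" for i H
  have "measure_pmf.expectation ?\<mu> (F i) \<le> measure_pmf.expectation ?\<mu> (F 0)"
    using N(1)
  proof (induction i)
    case (Suc i)
    then show ?case using expectation_dev_Suc [OF \<beta>, of i N] by (force simp: F_def [abs_def])
  qed simp
  also have "F 0 = (\<lambda>_. real N - 1)"
    by (auto simp: F_def bfw_dev_def bfw_unnumbered_def)
  also have "measure_pmf.expectation ?\<mu> (\<lambda>_. real N - 1) = real N - 1" by simp
  finally have E: "measure_pmf.expectation ?\<mu> (F i) \<le> real N" by simp
  have loc: "F i H = F i H'" if "\<And>E. E \<in> hedge_sets N \<Longrightarrow> H E > 0 \<longleftrightarrow> H' E > 0" for H H'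
    using bfw_local_positivity [OF N(2) that]
    by (simp add: F_def bfw_dev_def bfw_unnumbered_def)
  have int: "integrable (measure_pmf ?\<mu>) (F i)"
    by (rule integrable_measure_pmf_finite_range, rule finite_range_positivity [of N], rule loc)
  have pos: "F i H \<ge> 0" for H using bfw_unnumbered_nonneg [OF N(2)] by (simp add: F_def)
  have eN: "(e * real N)\<^sup>2 > 0" using e N by simp
  have "measure_pmf.prob ?\<mu> {H. \<bar>bfw_dev \<beta> N H i\<bar> \<ge> e * real N}
    \<le> measure_pmf.prob ?\<mu> {H \<in> space (measure_pmf ?\<mu>). F i H \<ge> (e * real N)\<^sup>2}"
  proof (intro measure_pmf.finite_measure_mono)
    show "{H. \<bar>bfw_dev \<beta> N H i\<bar> \<ge> e * real N} \<subseteq> {H \<in> space (measure_pmf ?\<mu>). F i H \<ge> (e * real N)\<^sup>2}"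
    proof safe
      fix H assume "\<bar>bfw_dev \<beta> N H i\<bar> \<ge> e * real N"
      then have "(e * real N)\<^sup>2 \<le> \<bar>bfw_dev \<beta> N H i\<bar>\<^sup>2" using e by (intro power_mono) auto
      then show "F i H \<ge> (e * real N)\<^sup>2"
        using bfw_unnumbered_nonneg [OF N(2), of H i] by (simp add: F_def)
    qed simp
  qed simp
  also have "\<dots> \<le> measure_pmf.expectation ?\<mu> (F i) / (e * real N)\<^sup>2"
    by (rule integral_Markov_inequality_measure [OF int, where A = "{}"]) (use pos eN in auto)
  also have "\<dots> \<le> real N / (e * real N)\<^sup>2" using E eN by (intro divide_right_mono) auto
  also have "\<dots> = 1 / (e\<^sup>2 * real N)" using N by (simp add: power2_eq_square field_simps)
  finally show ?thesis .
qed

section \<open>Fluid limit\<close>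

lemma choose_Suc_real: "real (n choose Suc m) = real (n choose m) * (real n - real m) / real (Suc m)"
proof -
  have "real (Suc m) * real (n choose Suc m) = (real n - real m) * real (n choose m)"
  proof (cases "m \<le> n")
    case True
    have "Suc m * (n choose Suc m) = (n - m) * (n choose m)"
      using True by (cases n) (auto simp: binomial_absorption binomial_absorb_comp simp del: mult_Suc binomial_Suc_Suc)
    then have "real (Suc m * (n choose Suc m)) = real ((n - m) * (n choose m))" by simp
    then show ?thesis using True by (simp only: of_nat_mult of_nat_diff)
  qed (simp add: binomial_eq_0)
  then show ?thesis by (simp add: field_simps del: of_nat_Suc)
qed

text \<open>Passing from \<open>m\<close> to \<open>Suc m\<close> multiplies the ratio by
  \<open>(f n - m) / (g n - m)\<close>, which tends to \<open>t\<close> because \<open>g n\<close>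
  tends to infinity.\<close>

lemma choose_ratio_tendsto:
  assumes lim: "(\<lambda>n. real (f n) / real (g n)) \<longlonglongrightarrow> t" and g: "filterlim g at_top sequentially"
  shows "(\<lambda>n. real (f n choose m) / real (g n choose m)) \<longlonglongrightarrow> t ^ m"
proof (induction m)
  case (Suc m)
  have g': "filterlim (\<lambda>n. real (g n)) at_top sequentially"
    by (rule filterlim_compose [OF filterlim_real_sequentially g])
  have "(\<lambda>n. (real (f n) / real (g n) - real m / real (g n)) / (1 - real m / real (g n))) \<longlonglongrightarrow> (t - 0) / (1 - 0)"
    by (intro tendsto_intros lim real_tendsto_divide_at_top g') auto
  then have "(\<lambda>n. real (f n choose m) / real (g n choose m) *
      ((real (f n) / real (g n) - real m / real (g n)) / (1 - real m / real (g n)))) \<longlonglongrightarrow> t ^ m * t"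
    by (intro tendsto_mult Suc) simp
  moreover have "\<forall>\<^sub>F n in sequentially. Suc m \<le> g n"
    using g unfolding filterlim_at_top by blast
  then have "\<forall>\<^sub>F n in sequentially. real (f n choose m) / real (g n choose m) *
      ((real (f n) / real (g n) - real m / real (g n)) / (1 - real m / real (g n)))
      = real (f n choose Suc m) / real (g n choose Suc m)"
  proof eventually_elim
    case (elim n)
    have "(real (f n) / real (g n) - real m / real (g n)) / (1 - real m / real (g n))
       = (real (f n) - real m) / (real (g n) - real m)"
      using elim by (simp add: field_simps)
    then show ?case by (simp add: choose_Suc_real del: binomial_Suc_Suc)
  qed
  ultimately show ?case by (auto intro: Lim_transform_eventually simp: mult.commute)
qed simp

text \<open>Summation over \<open>l\<close> uses the hockey-stick identity, and absorption turns
  \<open>N / (N choose (c + 2))\<close> into \<open>(c + 2) / ((N - 1) choose (c + 1))\<close>. The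
  series is finite, as its terms vanish for \<open>c \<ge> i\<close>; this form shows the
  coefficients of \<beta>'.\<close>

lemma sum_step_rate:
  assumes "N \<ge> 1"
  shows "(\<Sum>l<i. step_rate \<beta> N l)
    = (\<Sum>c. real (c + 2) * \<beta> (c + 2) * (real (i choose (c + 1)) / real ((N - 1) choose (c + 1))))"
proof -
  let ?r = "\<lambda>c. real N * \<beta> (c + 2) / real (N choose (c + 2))"
  have "(\<Sum>l<i. step_rate \<beta> N l) = (\<Sum>l<i. \<Sum>c<i. real (l choose c) * ?r c)"
    unfolding step_rate_def by (intro sum.cong refl sum.mono_neutral_left) auto
  also have "\<dots> = (\<Sum>c<i. (\<Sum>l<i. real (l choose c)) * ?r c)"
    by (subst sum.swap) (simp only: sum_distrib_right)
  also have "\<dots> = (\<Sum>c<i. real (i choose (c + 1)) * ?r c)"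
  proof (intro sum.cong refl)
    fix c
    have "(\<Sum>l<i. l choose c) = (i choose Suc c)"
      by (cases i) (simp_all add: lessThan_Suc_atMost sum_choose_upper del: binomial_Suc_Suc)
    then show "(\<Sum>l<i. real (l choose c)) * ?r c = real (i choose (c + 1)) * ?r c"
      by (simp flip: of_nat_sum)
  qed
  also have "\<dots> = (\<Sum>c<i. real (c + 2) * \<beta> (c + 2) * (real (i choose (c + 1)) / real ((N - 1) choose (c + 1))))"
  proof (intro sum.cong refl)
    fix c
    have "(c + 2) * (N choose (c + 2)) = N * ((N - 1) choose (c + 1))"
      using binomial_absorption [of "Suc c" N] by (simp del: binomial_Suc_Suc mult_Suc)
    then have "real (c + 2) * real (N choose (c + 2)) = real N * real ((N - 1) choose (c + 1))"
      by (metis of_nat_mult)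
    moreover have "real N > 0" using assms by simp
    \<comment> \<open>For \<open>c + 2 > N\<close> both binomials are 0 and both quotients are 0 by
      convention.\<close>
    ultimately have eq: "real N / real (N choose (c + 2)) = real (c + 2) / real ((N - 1) choose (c + 1))"
      by (cases "(N - 1) choose (c + 1) = 0"; cases "N choose (c + 2) = 0")
         (simp_all add: frac_eq_eq mult.commute del: binomial_eq_0_iff)
    have "real (i choose (c + 1)) * ?r c
       = real (i choose (c + 1)) * \<beta> (c + 2) * (real N / real (N choose (c + 2)))"
      by (simp del: binomial_Suc_Suc)
    also have "\<dots> = real (i choose (c + 1)) * \<beta> (c + 2) * (real (c + 2) / real ((N - 1) choose (c + 1)))"
      by (simp only: eq)
    finally show "real (i choose (c + 1)) * ?r c
       = real (c + 2) * \<beta> (c + 2) * (real (i choose (c + 1)) / real ((N - 1) choose (c + 1)))"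
      by (simp add: ac_simps del: binomial_Suc_Suc)
  qed
  also have "\<dots> = (\<Sum>c. real (c + 2) * \<beta> (c + 2) * (real (i choose (c + 1)) / real ((N - 1) choose (c + 1))))"
    by (rule suminf_finite [symmetric]) auto
  finally show ?thesis .
qed

lemma prod_survival: "(\<Prod>l<i. survival \<beta> N l) = exp (- (\<Sum>l<i. step_rate \<beta> N l))"
  by (simp add: survival_def exp_sum flip: sum_negf)

lemma summable_deriv_coeff:
  "summable (\<lambda>j. real j * \<beta> j) \<Longrightarrow> summable (\<lambda>c. real (c + 2) * \<beta> (c + 2))"
  by (rule summable_ignore_initial_segment)

text \<open>Tannery's theorem, that is dominated convergence for series, with the summable
  coefficients of \<beta>' as dominating terms.\<close>

lemma prod_survival_tendsto:
  assumes \<beta>: "\<forall>j\<ge>2. \<beta> j \<ge> 0" and sm: "summable (\<lambda>j. real j * \<beta> j)"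
    and lim: "(\<lambda>N. real (i N) / real N) \<longlonglongrightarrow> t" and t: "t < 1"
  shows "(\<lambda>N. \<Prod>l<i N. survival \<beta> N l) \<longlonglongrightarrow> exp (- beta_deriv \<beta> t)"
proof -
  let ?a = "\<lambda>c N. real (c + 2) * \<beta> (c + 2) * (real (i N choose (c + 1)) / real ((N - 1) choose (c + 1)))"
  have inf: "filterlim (\<lambda>N. N - 1) at_top sequentially"
    by (rule filterlim_minus_const_nat_at_top)
  have "(\<lambda>N. real N / real (N - 1)) \<longlonglongrightarrow> 1"
  proof (rule Lim_transform_eventually)
    show "(\<lambda>N. 1 / (1 - 1 / real N)) \<longlonglongrightarrow> 1"
      using tendsto_divide [OF tendsto_const [of 1] tendsto_diff [OF tendsto_const [of 1] lim_1_over_n]]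
      by simp
    show "\<forall>\<^sub>F N in sequentially. 1 / (1 - 1 / real N) = real N / real (N - 1)"
      using eventually_gt_at_top [of 1] by eventually_elim (simp add: field_simps)
  qed
  from tendsto_mult [OF lim this] have "(\<lambda>N. real (i N) / real N * (real N / real (N - 1))) \<longlonglongrightarrow> t"
    by simp
  then have lim': "(\<lambda>N. real (i N) / real (N - 1)) \<longlonglongrightarrow> t"
    by (rule Lim_transform_eventually)
       (use eventually_gt_at_top [of 0] in eventually_elim, simp)
  \<comment> \<open>Here \<open>t < 1\<close> is used: it makes the binomial ratios at most 1, as
    the domination requires.\<close>
  have le: "\<forall>\<^sub>F N in sequentially. i N \<le> N - 1"
    using order_tendstoD(2) [OF lim' t] eventually_gt_at_top [of 1]
    by eventually_elim (simp add: divide_less_eq)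
  have "(\<lambda>N. \<Sum>c. ?a c N) \<longlonglongrightarrow> (\<Sum>c. real (c + 2) * \<beta> (c + 2) * t ^ (c + 1))"
  proof (rule tannerys_theorem [THEN conjunct2, THEN conjunct2])
    show "(\<lambda>N. ?a c N) \<longlonglongrightarrow> real (c + 2) * \<beta> (c + 2) * t ^ (c + 1)" for c
      by (intro tendsto_mult tendsto_const choose_ratio_tendsto lim' inf)
    have "\<forall>\<^sub>F (c, N) in at_top \<times>\<^sub>F sequentially. i N \<le> N - 1"
      using le unfolding eventually_prod_filter
      by (intro exI [of _ "\<lambda>_. True"] exI [of _ "\<lambda>N. i N \<le> N - 1"]) simp
    then show "\<forall>\<^sub>F (c, N) in at_top \<times>\<^sub>F sequentially. norm (?a c N) \<le> real (c + 2) * \<beta> (c + 2)"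
    proof eventually_elim
      case (elim x)
      obtain c N where x: "x = (c, N)" by (cases x)
      have b: "\<beta> (c + 2) \<ge> 0" using \<beta> by simp
      have "real (i N choose (c + 1)) \<le> real ((N - 1) choose (c + 1))"
        using elim x by (intro of_nat_mono binomial_right_mono) auto
      then have "real (i N choose (c + 1)) / real ((N - 1) choose (c + 1)) \<le> 1"
        by (simp add: divide_le_eq)
      from mult_left_mono [OF this, of "real (c + 2) * \<beta> (c + 2)"] b
      show ?case by (simp add: x abs_mult)
    qed
    show "summable (\<lambda>c. real (c + 2) * \<beta> (c + 2))" by (rule summable_deriv_coeff [OF sm])
  qed simp
  then have "(\<lambda>N. exp (- (\<Sum>c. ?a c N))) \<longlonglongrightarrow> exp (- beta_deriv \<beta> t)"
    unfolding beta_deriv_def by (intro tendsto_intros)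
  then show ?thesis
    by (rule Lim_transform_eventually)
       (use eventually_ge_at_top [of 1] in eventually_elim, simp add: prod_survival sum_step_rate)
qed

section \<open>Uniform convergence of the corrected count\<close>

lemma prob_tendsto_0:
  fixes e :: "nat \<Rightarrow> real"
  assumes "\<forall>\<^sub>F N in sequentially. measure_pmf.prob (M N) (A N) \<le> e N" and "e \<longlonglongrightarrow> 0"
  shows "(\<lambda>N. measure_pmf.prob (M N) (A N)) \<longlonglongrightarrow> 0"
  by (rule tendsto_sandwich [OF _ assms(1) tendsto_const assms(2)]) simp

lemma beta_deriv_0 [simp]: "beta_deriv \<beta> 0 = 0"
  by (simp add: beta_deriv_def)

text \<open>Weierstrass M-test; finiteness of \<beta>'(1) gives continuity up to the endpoint
  1.\<close>

lemma continuous_on_beta_deriv: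
  assumes \<beta>: "\<forall>j\<ge>2. \<beta> j \<ge> 0" and sm: "summable (\<lambda>j. real j * \<beta> j)"
  shows "continuous_on {0..1} (beta_deriv \<beta>)"
proof -
  have "uniform_limit {0..1} (\<lambda>n t. \<Sum>j<n. real (j + 2) * \<beta> (j + 2) * t ^ (j + 1))
     (\<lambda>t. \<Sum>j. real (j + 2) * \<beta> (j + 2) * t ^ (j + 1)) sequentially"
  proof (rule Weierstrass_m_test [OF _ summable_deriv_coeff [OF sm]])
    fix j and t :: real assume "t \<in> {0..1}"
    then have "\<bar>t ^ (j + 1)\<bar> \<le> 1" by (simp add: power_le_one mult_le_one)
    from mult_left_mono [OF this, of "real (j + 2) * \<beta> (j + 2)"] \<beta>
    show "norm (real (j + 2) * \<beta> (j + 2) * t ^ (j + 1)) \<le> real (j + 2) * \<beta> (j + 2)"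
      by (simp add: abs_mult)
  qed
  then show ?thesis unfolding beta_deriv_def [abs_def]
    by (rule uniform_limit_theorem [rotated])
       (simp, intro always_eventually allI continuous_intros)
qed

text \<open>Both the bound at finitely many grid points and the small oscillation of the limit
  \<open>f\<close> between them extend to all times, because \<open>bfw_K\<close> is monotone in
  \<open>i\<close>.\<close>

lemma prob_K_dev_tendsto_0:
  assumes \<beta>: "\<forall>j\<ge>2. \<beta> j \<ge> 0" and sm: "summable (\<lambda>j. real j * \<beta> j)"
    and \<tau>: "\<tau> < 1" and e: "e > 0"
  shows "(\<lambda>N. measure_pmf.prob (poisson_hypergraph \<beta> N)
     {H. \<exists>i. real i \<le> real N * \<tau> \<and>
        \<bar>bfw_K (survival \<beta> N) N H i / real N - exp (- beta_deriv \<beta> (real i / real N))\<bar> > e}) \<longlonglongrightarrow> 0"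
    (is "(\<lambda>N. measure_pmf.prob _ (?B N)) \<longlonglongrightarrow> 0")
proof -
  define f where "f t = exp (- beta_deriv \<beta> t)" for t
  have "continuous_on {0..1} f"
    unfolding f_def by (intro continuous_intros continuous_on_beta_deriv \<beta> sm)
  then have "uniformly_continuous_on {0..1} f"
    by (intro compact_uniformly_continuous) auto
  then obtain \<eta> where \<eta>: "\<eta> > 0"
    and osc: "\<And>s t. s \<in> {0..1} \<Longrightarrow> t \<in> {0..1} \<Longrightarrow> \<bar>s - t\<bar> < \<eta> \<Longrightarrow> \<bar>f s - f t\<bar> < e / 4"
    unfolding uniformly_continuous_on_def dist_real_def using e
    by (metis divide_pos_pos zero_less_numeral)
  have "(\<lambda>n. 1 / real n) \<longlonglongrightarrow> 0" by (rule lim_1_over_n)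
  moreover have "min \<eta> (1 - \<tau>) > 0" using \<eta> \<tau> by simp
  ultimately have "\<forall>\<^sub>F n in sequentially. 1 / real n < min \<eta> (1 - \<tau>) \<and> n \<ge> 1"
    by (intro eventually_conj order_tendstoD eventually_ge_at_top) auto
  \<comment> \<open>A mesh below \<eta> controls the oscillation of \<open>f\<close>; a mesh below
    \<open>1 - \<tau>\<close> keeps the grid points used away from 1, where the survival products
    are known to converge.\<close>
  then obtain n where n: "1 / real n < \<eta>" "1 / real n < 1 - \<tau>" "n \<ge> 1"
    unfolding eventually_sequentially by auto
  define a where "a N g = (N * g) div n" for N g
  have "(\<lambda>N. \<Prod>l<a N g. survival \<beta> N l) \<longlonglongrightarrow> f (real g / real n)" if g: "g < n" for g
    unfolding f_def
  proof (rule prod_survival_tendsto [OF \<beta> sm])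
    have "(\<lambda>N. real g / real n - real ((N * g) mod n) / real n * (1 / real N)) \<longlonglongrightarrow> real g / real n - 0"
    proof (intro tendsto_diff tendsto_const)
      show "(\<lambda>N. real ((N * g) mod n) / real n * (1 / real N)) \<longlonglongrightarrow> 0"
      proof (rule tendsto_sandwich [OF _ _ tendsto_const lim_1_over_n])
        show "\<forall>\<^sub>F N in sequentially. real ((N * g) mod n) / real n * (1 / real N) \<le> 1 / real N"
          using n by (intro always_eventually allI mult_left_le_one_le)
            (auto simp: divide_le_eq less_imp_le)
      qed simp
    qed
    moreover have "\<forall>\<^sub>F N in sequentially.
      real g / real n - real ((N * g) mod n) / real n * (1 / real N) = real (a N g) / real N"
      using eventually_gt_at_top [of 0]
    proof eventually_elim
      case (elim N)
      have "real (N * g) = real (a N g * n + (N * g) mod n)" by (simp add: a_def)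
      then have "real N * real g = real (a N g) * real n + real ((N * g) mod n)" by simp
      then show ?case using elim n by (simp add: field_simps)
    qed
    ultimately show "(\<lambda>N. real (a N g) / real N) \<longlonglongrightarrow> real g / real n"
      by (simp add: Lim_transform_eventually)
    show "real g / real n < 1" using g by simp
  qed
  then have "\<forall>\<^sub>F N in sequentially. \<bar>(\<Prod>l<a N g. survival \<beta> N l) - f (real g / real n)\<bar> < e / 4"
    if "g < n" for g
    using that tendstoD [of _ "f (real g / real n)" sequentially "e / 4"] e by (simp add: dist_real_def)
  then have "\<forall>\<^sub>F N in sequentially. \<forall>g\<in>{..<n}. \<bar>(\<Prod>l<a N g. survival \<beta> N l) - f (real g / real n)\<bar> < e / 4"
    by (intro eventually_ball_finite) auto
  then have ev: "\<forall>\<^sub>F N in sequentially. N \<ge> 1 \<and>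
     (\<forall>g\<in>{..<n}. \<bar>(\<Prod>l<a N g. survival \<beta> N l) - f (real g / real n)\<bar> < e / 4)"
    by (intro eventually_conj eventually_ge_at_top)
  show ?thesis
  proof (rule prob_tendsto_0)
    \<comment> \<open>A union bound over \<open>n\<close> grid points, each contributing
      \<open>prob_dev_ge\<close> at level \<open>e / 4\<close>.\<close>
    show "(\<lambda>N. real n * (16 / e\<^sup>2 * (1 / real N))) \<longlonglongrightarrow> 0"
      by (intro tendsto_mult_right_zero lim_1_over_n)
    show "\<forall>\<^sub>F N in sequentially. measure_pmf.prob (poisson_hypergraph \<beta> N) (?B N)
        \<le> real n * (16 / e\<^sup>2 * (1 / real N))"
      using ev
    proof eventually_elim
      case (elim N)
      then have N: "N \<ge> 1" by simp
      let ?W = "\<lambda>g. {H. \<bar>bfw_dev \<beta> N H (a N g)\<bar> \<ge> e / 4 * real N}"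
      have "?B N \<subseteq> (\<Union>g\<in>{..<n}. ?W g)"
      proof
        fix H assume H: "H \<in> ?B N"
        show "H \<in> (\<Union>g\<in>{..<n}. ?W g)"
        proof (rule ccontr)
          assume "H \<notin> (\<Union>g\<in>{..<n}. ?W g)"
          then have W: "\<bar>bfw_dev \<beta> N H (a N g)\<bar> < e / 4 * real N" if "g < n" for g
            using that by (force simp: not_le)
          let ?K = "\<lambda>i. bfw_K (survival \<beta> N) N H i / real N"
          have grid: "\<bar>?K (a N g) - f (real g / real n)\<bar> < e / 2" if "g < n" for g
          proof -
            have "?K (a N g) - (\<Prod>l<a N g. survival \<beta> N l) = bfw_dev \<beta> N H (a N g) / real N"
              using N by (simp add: bfw_dev_def diff_divide_distrib)
            also have "\<bar>\<dots>\<bar> < e / 4" using W [OF that] N by (simp add: divide_less_eq)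
            finally have "\<bar>?K (a N g) - (\<Prod>l<a N g. survival \<beta> N l)\<bar> < e / 4" .
            moreover have "\<bar>(\<Prod>l<a N g. survival \<beta> N l) - f (real g / real n)\<bar> < e / 4"
              using elim that by blast
            ultimately show ?thesis by linarith
          qed
          obtain i where i: "real i \<le> real N * \<tau>" and bad: "\<bar>?K i - f (real i / real N)\<bar> > e"
            using H by (auto simp: f_def)
          define g where "g = (i * n) div N"
          have gN: "g * N \<le> i * n" "i * n < Suc g * N"
            using N by (auto simp: g_def dividend_less_div_times)
          \<comment> \<open>As the mesh is less than \<open>1 - \<tau>\<close>, the grid point
            following \<open>i / N\<close> is still below 1, that is
            \<open>Suc g < n\<close>.\<close>
          have "real N * (1 / real n) < real N * (1 - \<tau>)"
            using n N by (intro mult_strict_left_mono) auto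
          then have "real i < real N - real N / real n" using i by (simp add: algebra_simps)
          then have "real i * real n < real N * (real n - 1)"
            using n by (simp add: field_simps)
          then have "real (i * n) < real (N * (n - 1))" using n by simp
          then have "i * n < N * (n - 1)" by (simp only: of_nat_less_iff)
          then have "i * n < N * n" by (rule less_le_trans) simp
          then have iN: "i < N" by simp
          from gN(1) \<open>i * n < N * (n - 1)\<close> have "g * N < N * (n - 1)" by (rule le_less_trans)
          then have g: "Suc g < n" by (simp add: less_diff_conv mult.commute [of g])
          have "a N g \<le> (i * n) div n" unfolding a_def
            using gN(1) by (intro div_le_mono) (simp add: mult.commute)
          then have a1: "a N g \<le> i" using n by simp
          have "(i * n) div n \<le> a N (Suc g)" unfolding a_def
            using gN(2) by (intro div_le_mono) (simp add: mult.commute)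
          then have a2: "i \<le> a N (Suc g)" using n by simp
          have K: "?K i \<le> ?K (a N g)" "?K (a N (Suc g)) \<le> ?K i"
            using bfw_K_antimono [OF survival_bounds [OF \<beta>], where N = N and H = H] a1 a2
            by (auto intro: divide_right_mono)
          have pos: "real n > 0" "real N > 0" using n N by auto
          have "real (g * N) \<le> real (i * n)" "real (i * n) < real (Suc g * N)"
            using gN by (simp_all only: of_nat_le_iff of_nat_less_iff)
          then have "real g * real N \<le> real i * real n" "real i * real n < real (Suc g) * real N"
            by (simp_all only: of_nat_mult)
          then have r: "real g / real n \<le> real i / real N" "real i / real N < real (Suc g) / real n"
            using pos by (simp_all add: divide_le_eq le_divide_eq divide_less_eq less_divide_eq mult.commute)
          have mesh: "real (Suc g) / real n = real g / real n + 1 / real n"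
            by (simp add: add_divide_distrib)
          have rng: "real g / real n \<in> {0..1}" "real (Suc g) / real n \<in> {0..1}" "real i / real N \<in> {0..1}"
            using g iN pos by auto
          have "\<bar>f (real g / real n) - f (real i / real N)\<bar> < e / 4"
            using r mesh n by (intro osc rng) auto
          moreover have "\<bar>f (real (Suc g) / real n) - f (real i / real N)\<bar> < e / 4"
            using r mesh n by (intro osc rng) auto
          \<comment> \<open>The value at \<open>i\<close> lies between two grid values; each is
            within \<open>e / 2\<close> of the limit there, and the limit moves by at most
            \<open>e / 4\<close>.\<close>
          ultimately show False
            using bad K grid [of g] grid [of "Suc g"] g e by linarith
        qed
      qed
      then have "measure_pmf.prob (poisson_hypergraph \<beta> N) (?B N)
         \<le> measure_pmf.prob (poisson_hypergraph \<beta> N) (\<Union>g\<in>{..<n}. ?W g)"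
        by (intro measure_pmf.finite_measure_mono) auto
      also have "\<dots> \<le> (\<Sum>g<n. measure_pmf.prob (poisson_hypergraph \<beta> N) (?W g))"
        by (intro measure_pmf.finite_measure_subadditive_finite) auto
      also have "\<dots> \<le> (\<Sum>g<n. 16 / e\<^sup>2 * (1 / real N))"
      proof (rule sum_mono)
        fix g assume "g \<in> {..<n}"
        then have "N * g \<le> N * n" by simp
        from div_le_mono [OF this, of n] have "a N g \<le> N" using n by (simp add: a_def)
        from prob_dev_ge [OF \<beta> this N, of "e / 4"] e
        show "measure_pmf.prob (poisson_hypergraph \<beta> N) (?W g) \<le> 16 / e\<^sup>2 * (1 / real N)"
          by (simp add: power_divide)
      qed
      also have "\<dots> = real n * (16 / e\<^sup>2 * (1 / real N))" by simp
      finally show ?case .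
    qed
  qed
qed

section \<open>The limit function and its crossing point\<close>

text \<open>The infimum is at most 1 because z(1) < 0. There z cannot be negative, by continuity
  from the left and z(0) = 0, nor positive, because negative values occur arbitrarily close to the
  right.\<close>

lemma zfun_facts:
  assumes \<beta>: "\<forall>j\<ge>2. \<beta> j \<ge> 0" and sm: "summable (\<lambda>j. real j * \<beta> j)"
  shows "continuous_on {0..1} (zfun \<beta>)"
    and "0 \<le> tstar \<beta>" and "tstar \<beta> < 1" and "zfun \<beta> (tstar \<beta>) = 0"
    and "\<And>t. 0 \<le> t \<Longrightarrow> t < tstar \<beta> \<Longrightarrow> zfun \<beta> t \<ge> 0"
    and "\<And>\<eta>. \<eta> > 0 \<Longrightarrow> \<exists>t. tstar \<beta> \<le> t \<and> t < tstar \<beta> + \<eta> \<and> t < 1 \<and> zfun \<beta> t < 0"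
proof -
  let ?S = "{t. t \<ge> 0 \<and> zfun \<beta> t < 0}" and ?z = "zfun \<beta>" and ?t = "tstar \<beta>"
  show cont: "continuous_on {0..1} ?z"
    unfolding zfun_def [abs_def] by (intro continuous_intros continuous_on_beta_deriv \<beta> sm)
  have 1: "1 \<in> ?S" by (simp add: zfun_def)
  have bdd: "bdd_below ?S" by (intro bdd_belowI [of _ 0]) auto
  show t0: "0 \<le> ?t" unfolding tstar_def using 1 by (intro cInf_greatest) blast+
  have t1: "?t \<le> 1" unfolding tstar_def using 1 bdd by (intro cInf_lower) auto
  show nonneg: "?z t \<ge> 0" if "0 \<le> t" "t < ?t" for t
    using cInf_lower [OF _ bdd, of t] that by (force simp: tstar_def)
  have lip: "\<exists>d>0. \<forall>s\<in>{0..1}. \<bar>s - ?t\<bar> < d \<longrightarrow> \<bar>?z s - ?z ?t\<bar> < r" if "r > 0" for r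
    using cont that t0 t1 unfolding continuous_on_iff dist_real_def by auto
  have le: "?z ?t \<ge> 0"
  proof (rule ccontr)
    assume "\<not> ?z ?t \<ge> 0"
    then obtain d where d: "d > 0" "\<forall>s\<in>{0..1}. \<bar>s - ?t\<bar> < d \<longrightarrow> \<bar>?z s - ?z ?t\<bar> < - ?z ?t"
      using lip [of "- ?z ?t"] by auto
    show False
    proof (cases "?t = 0")
      case True
      then show False using \<open>\<not> ?z ?t \<ge> 0\<close> by (simp add: zfun_def)
    next
      case False
      define s where "s = max 0 (?t - d / 2)"
      have "0 \<le> s" "s < ?t" "s \<in> {0..1}" "\<bar>s - ?t\<bar> < d" using False t0 t1 d by (auto simp: s_def)
      then have "\<bar>?z s - ?z ?t\<bar> < - ?z ?t" "?z s \<ge> 0" using d nonneg by auto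
      then show False by linarith
    qed
  qed
  then have "?t \<noteq> 1" using 1 by auto
  with t1 show t1': "?t < 1" by simp
  show ex: "\<exists>t. ?t \<le> t \<and> t < ?t + \<eta> \<and> t < 1 \<and> ?z t < 0" if "\<eta> > 0" for \<eta>
  proof -
    have "Inf ?S < min (?t + \<eta>) 1" using that t1' by (simp add: tstar_def)
    from cInf_lessD [OF _ this] 1 obtain t where "t \<in> ?S" "t < min (?t + \<eta>) 1" by blast
    moreover from \<open>t \<in> ?S\<close> have "?t \<le> t" unfolding tstar_def by (intro cInf_lower bdd)
    ultimately show ?thesis by auto
  qed
  show "?z ?t = 0"
  proof (rule ccontr)
    assume "?z ?t \<noteq> 0"
    with le have p: "?z ?t > 0" by simp
    then obtain d where d: "d > 0" "\<forall>s\<in>{0..1}. \<bar>s - ?t\<bar> < d \<longrightarrow> \<bar>?z s - ?z ?t\<bar> < ?z ?t"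
      using lip by blast
    obtain t where t: "?t \<le> t" "t < ?t + d" "t < 1" "?z t < 0" using ex [OF d(1)] by blast
    then have "\<bar>?z t - ?z ?t\<bar> < ?z ?t" using t0 d by auto
    with t p show False by linarith
  qed
qed

section \<open>The stopped walk\<close>

text \<open>The lower bound on the walk allows at most \<open>1 + e N \<le> 2 e N\<close> patches,
  and \<open>bfw_K_bounds\<close> then determines the walk from \<open>bfw_K\<close> up to that
  number. A further \<open>e\<close> comes from \<open>bfw_K\<close> itself.\<close>

lemma zfun_near:
  assumes \<beta>: "\<forall>j\<ge>2. \<beta> j \<ge> 0" and e: "0 \<le> e" "e * real N \<ge> 1"
    and K: "\<bar>bfw_K (survival \<beta> N) N H i / real N - exp (- beta_deriv \<beta> (real i / real N))\<bar> \<le> e"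
    and Z: "\<And>j. j \<le> i \<Longrightarrow> real_of_int (bfw_Z N H j) \<ge> - e * real N"
  shows "\<bar>real_of_int (bfw_Z N H i) / real N - zfun \<beta> (real i / real N)\<bar> \<le> 3 * e"
proof -
  have N: "real N > 0" using e by (cases "N = 0") auto
  have "bfw_patches N H i \<le> 1 + \<lfloor>e * real N\<rfloor>"
  proof (rule bfw_patches_le)
    fix j assume "j \<le> i"
    then have "real_of_int (- bfw_Z N H j) \<le> e * real N" using Z [of j] by simp
    then have "- bfw_Z N H j \<le> \<lfloor>e * real N\<rfloor>" by (simp only: le_floor_iff)
    then show "bfw_Z N H j \<ge> - \<lfloor>e * real N\<rfloor>" by simp
  qed (use e in auto)
  then have "real_of_int (bfw_patches N H i) \<le> 1 + e * real N" by linarith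
  then have P: "0 \<le> real_of_int (bfw_patches N H i)" "real_of_int (bfw_patches N H i) \<le> 2 * e * real N"
    using bfw_patches_ge_1 [of N H i] e by linarith+
  have "real N - real i - of_int (bfw_Z N H i) - of_int (bfw_patches N H i) \<le> bfw_K (survival \<beta> N) N H i"
     "bfw_K (survival \<beta> N) N H i \<le> real N - real i - of_int (bfw_Z N H i)"
    using bfw_K_bounds [OF survival_bounds [OF \<beta>], where N = N and H = H and i = i]
    by (auto simp: bfw_unnumbered_eq)
  then have "\<bar>real_of_int (bfw_Z N H i) - (real N - real i - bfw_K (survival \<beta> N) N H i)\<bar> \<le> 2 * e * real N"
    using P by linarith
  then have "\<bar>real_of_int (bfw_Z N H i) - (real N - real i - bfw_K (survival \<beta> N) N H i)\<bar> / real N \<le> 2 * e"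
    using N by (simp add: divide_le_eq)
  also have "\<bar>real_of_int (bfw_Z N H i) - (real N - real i - bfw_K (survival \<beta> N) N H i)\<bar> / real N
     = \<bar>real_of_int (bfw_Z N H i) / real N - (1 - real i / real N - bfw_K (survival \<beta> N) N H i / real N)\<bar>"
  proof -
    have "(real_of_int (bfw_Z N H i) - (real N - real i - bfw_K (survival \<beta> N) N H i)) / real N
       = real_of_int (bfw_Z N H i) / real N - (1 - real i / real N - bfw_K (survival \<beta> N) N H i / real N)"
      using N by (simp add: diff_divide_distrib)
    from this [symmetric] show ?thesis using N by (simp only: abs_divide abs_of_pos)
  qed
  finally show ?thesis using K unfolding zfun_def by linarith
qed

text \<open>A deterministic statement about one hypergraph. The walk follows z until it first falls
  below \<open>M\<close>. This happens by about \<open>t'\<close>, where z is clearly negative, and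
  not before \<open>tstar - \<eta>\<close>, since z is at least \<kappa> there. From then on the
  stopped walk equals \<open>M\<close>, close to the value 0 of z at \<open>tstar\<close>.\<close>

lemma Ztilde_near:
  fixes \<delta> e \<eta> \<eta>' c \<kappa> t' :: real
  assumes \<beta>: "\<forall>j\<ge>2. \<beta> j \<ge> 0" and sm: "summable (\<lambda>j. real j * \<beta> j)"
    and \<delta>: "0 < \<delta>"
    and e: "0 < e" "12 * e \<le> r" "12 * e \<le> c" "3 * e < \<kappa>"
    and osc: "\<And>s t. s \<in> {0..1} \<Longrightarrow> t \<in> {0..1} \<Longrightarrow> \<bar>s - t\<bar> \<le> \<eta> \<Longrightarrow> \<bar>zfun \<beta> s - zfun \<beta> t\<bar> \<le> r / 4"
    and osc': "\<And>s t. s \<in> {0..1} \<Longrightarrow> t \<in> {0..1} \<Longrightarrow> \<bar>s - t\<bar> \<le> \<eta>' \<Longrightarrow> \<bar>zfun \<beta> s - zfun \<beta> t\<bar> \<le> c / 4"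
    and t': "tstar \<beta> \<le> t'" "t' \<le> tstar \<beta> + \<eta>" "t' < 1" "zfun \<beta> t' \<le> - c"
    and \<kappa>: "\<And>s. \<delta> / 2 \<le> s \<Longrightarrow> s \<le> tstar \<beta> - \<eta> \<Longrightarrow> zfun \<beta> s \<ge> \<kappa>"
    and N: "N \<ge> 1" "1 / real N \<le> e" "1 / real N \<le> \<eta>" "1 / real N \<le> \<eta>'" "1 / real N \<le> \<delta> / 2"
    and K: "\<And>i. real i \<le> real N * t' \<Longrightarrow>
      \<bar>bfw_K (survival \<beta> N) N H i / real N - exp (- beta_deriv \<beta> (real i / real N))\<bar> \<le> e"
    and Z: "\<And>i. i \<le> nat \<lfloor>real N * \<delta>\<rfloor> \<Longrightarrow> real_of_int (bfw_Z N H i) \<ge> - e * real N"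
    and t: "t \<in> {0..1}"
  shows "\<bar>real_of_int (bfw_Ztilde N \<delta> H (nat \<lfloor>real N * t\<rfloor>)) / real N - zfun \<beta> (min t (tstar \<beta>))\<bar> \<le> r"
    and "t \<le> tstar \<beta> - \<eta> \<Longrightarrow> bfw_Ztilde N \<delta> H (nat \<lfloor>real N * t\<rfloor>) = bfw_Z N H (nat \<lfloor>real N * t\<rfloor>)"
proof -
  note zf = zfun_facts [OF \<beta> sm]
  define m where "m = nat \<lfloor>real N * \<delta>\<rfloor>"
  define M where "M = Min (bfw_Z N H ` {..m})"
  define below where "below j \<longleftrightarrow> m < j \<and> bfw_Z N H j < M" for j
  define i where "i = nat \<lfloor>real N * t\<rfloor>"
  have Np: "real N > 0" using N by simp
  have M_le: "M \<le> bfw_Z N H j" if "j \<le> m" for j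
    unfolding M_def using that by (intro Min_le) auto
  then have M0: "M \<le> 0" using M_le [of 0] by simp
  have "M \<in> bfw_Z N H ` {..m}" unfolding M_def by (intro Min_in) auto
  then have Mge: "real_of_int M \<ge> - e * real N" using Z by (auto simp: m_def)
  have Zt: "bfw_Ztilde N \<delta> H i = (if \<exists>j\<le>i. below j then M else bfw_Z N H i)"
    unfolding bfw_Ztilde_def Let_def by (auto simp: M_def m_def below_def)
  have ZM: "bfw_Z N H j \<ge> M" if "\<not> below j" for j
    using that M_le [of j] by (cases "j \<le> m") (auto simp: below_def)
  have fl: "real l \<le> real N * s" "real l > real N * s - 1" if "l = nat \<lfloor>real N * s\<rfloor>" "s \<ge> 0" for l s
    using that Np by auto
  have flN: "real l / real N \<le> s \<and> s - 1 / real N < real l / real N"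
    if "l = nat \<lfloor>real N * s\<rfloor>" "s \<ge> 0" for l s
  proof -
    have "(real N * s - 1) / real N < real l / real N"
      using fl(2) [OF that] Np by (rule divide_strict_right_mono)
    then have "s - 1 / real N < real l / real N" using Np by (simp add: diff_divide_distrib)
    then show ?thesis using fl(1) [OF that] Np by (simp add: divide_le_eq mult.commute)
  qed
  have near: "\<bar>real_of_int (bfw_Z N H l) / real N - zfun \<beta> (real l / real N)\<bar> \<le> 3 * e"
    if l: "real l \<le> real N * t'" "\<And>j. j \<le> l \<Longrightarrow> \<not> below j" for l
  proof (rule zfun_near [OF \<beta> _ _ K [OF l(1)]])
    show "1 \<le> e * real N" using N(2) Np by (simp add: field_simps)
    show "real_of_int (bfw_Z N H j) \<ge> - e * real N" if "j \<le> l" for j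
      using ZM [OF l(2) [OF that]] Mge by linarith
  qed (use e in simp)
  \<comment> \<open>If the walk had not fallen below \<open>M\<close> by \<open>t'\<close>, it would
    at once be at least \<open>- e N\<close> and, by \<open>near\<close>, at most about
    \<open>- c N / 2\<close>.\<close>
  have early: "real l \<le> real N * t'" if nb: "\<And>j. j \<le> l \<Longrightarrow> \<not> below j" for l
  proof (rule ccontr)
    assume late: "\<not> real l \<le> real N * t'"
    define l' where "l' = nat \<lfloor>real N * t'\<rfloor>"
    have t'0: "t' \<ge> 0" using t' zf(2) by linarith
    note l' = fl [OF l'_def t'0] flN [OF l'_def t'0]
    have "l' \<le> l" using late l' by linarith
    then have nb': "\<not> below j" if "j \<le> l'" for j using nb that by simp
    have "\<bar>zfun \<beta> (real l' / real N) - zfun \<beta> t'\<bar> \<le> c / 4"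
    proof (rule osc')
      show "real l' / real N \<in> {0..1}" using l' t' by auto
      show "\<bar>real l' / real N - t'\<bar> \<le> \<eta>'" using l' N by linarith
    qed (use t' t'0 in auto)
    then have "real_of_int (bfw_Z N H l') / real N \<le> - c + c / 4 + 3 * e"
      using near [OF l'(1) nb'] t'(4) by linarith
    moreover have "real_of_int (bfw_Z N H l') \<ge> - e * real N" using ZM [OF nb' [OF order_refl]] Mge by linarith
    then have "real_of_int (bfw_Z N H l') / real N \<ge> - e" using Np by (simp add: le_divide_eq)
    ultimately show False using e by linarith
  qed
  note i = flN [OF i_def]
  have i': "real i / real N \<le> t" "t - 1 / real N < real i / real N" using i t by auto
  have i01: "real i / real N \<in> {0..1}" using i' t by auto
  have ts: "tstar \<beta> \<in> {0..1}" "min t (tstar \<beta>) \<in> {0..1}" using zf(2,3) t by auto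
  have stopped: "t > tstar \<beta> - \<eta>" if ex: "\<exists>j\<le>i. below j"
  proof -
    define T where "T = (LEAST j. below j)"
    from ex obtain j0 where j0: "below j0" "j0 \<le> i" by auto
    have bT: "below T" unfolding T_def by (rule LeastI [of below, OF j0(1)])
    have Ti: "T \<le> i" using Least_le [of below, OF j0(1)] j0(2) by (simp add: T_def)
    obtain l where l: "T = Suc l" using bT by (cases T) (auto simp: below_def)
    have nb: "\<not> below j" if "j \<le> l" for j using not_less_Least [of j below] that l by (simp add: T_def)
    \<comment> \<open>The walk goes down by at most 1 per step, so just before falling below
      \<open>M \<le> 0\<close> it is at most 0.\<close>
    have "bfw_Z N H l \<le> bfw_Z N H T + 1" using bfw_Z_Suc_ge [of N H l] l by simp
    then have Zl: "bfw_Z N H l \<le> 0" using bT M0 by (simp add: below_def)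
    have "real_of_int (bfw_Z N H l) / real N \<le> 0" using Zl Np by (simp add: divide_le_0_iff)
    moreover have "\<bar>real_of_int (bfw_Z N H l) / real N - zfun \<beta> (real l / real N)\<bar> \<le> 3 * e"
      by (rule near [OF early [OF nb] nb])
    ultimately have z: "zfun \<beta> (real l / real N) \<le> 3 * e" by linarith
    \<comment> \<open>Rounding in \<open>m\<close> costs at most \<open>1 / N\<close>; this is why
      \<kappa> bounds z from \<open>\<delta> / 2\<close> on and not only from \<delta> on.\<close>
    have "m \<le> l" using bT l by (simp add: below_def)
    then have "real m / real N \<le> real l / real N" using Np by (simp add: divide_right_mono)
    then have "\<delta> / 2 \<le> real l / real N" using flN [OF m_def] N \<delta> by linarith
    then have "real l / real N > tstar \<beta> - \<eta>" using \<kappa> [of "real l / real N"] z e by linarith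
    moreover have "real l / real N \<le> real i / real N" using Ti l Np by (simp add: divide_right_mono)
    ultimately show ?thesis using i' by linarith
  qed
  show "\<bar>real_of_int (bfw_Ztilde N \<delta> H (nat \<lfloor>real N * t\<rfloor>)) / real N - zfun \<beta> (min t (tstar \<beta>))\<bar> \<le> r"
  proof (cases "\<exists>j\<le>i. below j")
    case True
    have "\<bar>zfun \<beta> (min t (tstar \<beta>)) - zfun \<beta> (tstar \<beta>)\<bar> \<le> r / 4"
    proof (intro osc ts)
      have "0 < 1 / real N" using Np by simp
      then have "\<eta> > 0" using N(3) by linarith
      then show "\<bar>min t (tstar \<beta>) - tstar \<beta>\<bar> \<le> \<eta>" using stopped [OF True] by linarith
    qed
    moreover have "real_of_int M / real N \<ge> - e" using Mge Np by (simp add: le_divide_eq)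
    moreover have "real_of_int M / real N \<le> 0" using M0 Np by (simp add: divide_le_0_iff)
    moreover have ZtM: "bfw_Ztilde N \<delta> H i = M" using Zt True by simp
    ultimately show ?thesis using e zf(4) unfolding i_def [symmetric] ZtM by linarith
  next
    case False
    then have nb: "\<not> below j" if "j \<le> i" for j using that by auto
    from early [OF nb] have "real i / real N \<le> t'" using Np by (simp add: divide_le_eq mult.commute)
    then have "\<bar>real i / real N - min t (tstar \<beta>)\<bar> \<le> \<eta>"
      using i' N t' by linarith
    then have "\<bar>zfun \<beta> (real i / real N) - zfun \<beta> (min t (tstar \<beta>))\<bar> \<le> r / 4"
      by (intro osc ts i01)
    moreover have "\<bar>real_of_int (bfw_Z N H i) / real N - zfun \<beta> (real i / real N)\<bar> \<le> 3 * e"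
      by (rule near [OF early [OF nb] nb])
    moreover have ZtZ: "bfw_Ztilde N \<delta> H i = bfw_Z N H i" using Zt False by simp
    ultimately show ?thesis using e unfolding i_def [symmetric] ZtZ by linarith
  qed
  show "bfw_Ztilde N \<delta> H (nat \<lfloor>real N * t\<rfloor>) = bfw_Z N H (nat \<lfloor>real N * t\<rfloor>)" if "t \<le> tstar \<beta> - \<eta>"
    using Zt stopped that unfolding i_def [symmetric] by auto
qed

section \<open>Choice of constants and conclusion\<close>

text \<open>Since \<open>alpha k = 1 - 1 / (2 k - 3)\<close> is below 1, the initial period excluded
  in \<open>S_event\<close> has length o(N).\<close>

lemma powr_scale_tendsto_0:
  assumes "k \<ge> 2"
  shows "(\<lambda>N. real N powr (alpha k - 1) * R\<^sup>2) \<longlonglongrightarrow> 0"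
proof -
  have "2 * real k - 3 > 0" using assms by linarith
  then have "alpha k - 1 < 0" by (simp add: alpha_def field_simps)
  then have "(\<lambda>N. real N powr (alpha k - 1)) \<longlonglongrightarrow> 0"
    by (intro tendsto_neg_powr filterlim_real_sequentially)
  then show ?thesis by (rule tendsto_mult_left_zero)
qed

text \<open>The walk is nonpositive at time \<open>N\<close>, which eventually exceeds
  \<open>N powr alpha k * R\<^sup>2\<close>. For \<open>\<delta> \<ge> 1\<close> the event would
  therefore be certain and its limit 1.\<close>

lemma delta_less_1:
  assumes k: "k \<ge> 2"
    and lim: "\<forall>R. (\<lambda>N. measure_pmf.prob (poisson_hypergraph \<beta> N) (S_event k N R \<delta>)) \<longlonglongrightarrow> L R"
    and L: "(L \<longlongrightarrow> 0) at_top"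
  shows "\<delta> < 1"
proof (rule ccontr)
  assume "\<not> \<delta> < 1"
  have "L R = 1" for R
  proof -
    have "\<forall>\<^sub>F N in sequentially. real N powr (alpha k - 1) * R\<^sup>2 < 1"
      by (rule order_tendstoD(2) [OF powr_scale_tendsto_0 [OF k]]) simp
    then have "\<forall>\<^sub>F N in sequentially. 1 = measure_pmf.prob (poisson_hypergraph \<beta> N) (S_event k N R \<delta>)"
      using eventually_ge_at_top [of 1]
    proof eventually_elim
      case (elim N)
      then have Np: "real N > 0" by simp
      have "real N powr alpha k * R\<^sup>2 = real N * (real N powr (alpha k - 1) * R\<^sup>2)"
        using Np by (simp add: powr_diff)
      also have "\<dots> \<le> real N * 1" using elim by (intro mult_left_mono) auto
      finally have "real N powr alpha k * R\<^sup>2 \<le> real N" by simp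
      moreover have "real N \<le> real N * \<delta>" using \<open>\<not> \<delta> < 1\<close> Np by simp
      ultimately have "S_event k N R \<delta> = UNIV"
        using bfw_Z_N [of N] elim by (auto simp: S_event_def)
      then show ?case by simp
    qed
    from Lim_transform_eventually [OF tendsto_const this] show "L R = 1"
      using lim LIMSEQ_unique by blast
  qed
  then have "(L \<longlongrightarrow> 1) at_top" by (simp add: tendsto_eventually)
  with L tendsto_unique [of at_top L 0 1] show False by simp
qed

text \<open>The constants of \<open>Ztilde_near\<close> are fixed one after the other: \<eta> from
  \<open>r\<close> and \<zeta>, then \<open>t'\<close> and \<open>c\<close>, then \<open>d'\<close>
  and \<kappa>, then \<open>e\<close>. What remains is the failure of the bound on
  \<open>bfw_K\<close> or the event \<open>S_event\<close>.\<close>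

lemma Ztilde_tendsto:
  fixes \<beta> :: "nat \<Rightarrow> real"
  assumes k: "k \<ge> 2" and \<beta>: "\<forall>j\<ge>2. \<beta> j \<ge> 0" and sm: "summable (\<lambda>j. real j * \<beta> j)"
    and nozero: "\<forall>t. 0 < t \<and> t < tstar \<beta> \<longrightarrow> zfun \<beta> t \<noteq> 0"
    and \<delta>: "\<delta> > 0"
    and lim: "\<forall>R. (\<lambda>N. measure_pmf.prob (poisson_hypergraph \<beta> N) (S_event k N R \<delta>)) \<longlonglongrightarrow> L R"
    and L: "(L \<longlongrightarrow> 0) at_top"
    and r: "r > 0" and \<zeta>: "\<zeta> > 0"
  shows "(\<lambda>N. measure_pmf.prob (poisson_hypergraph \<beta> N)
    {H. \<not> (\<forall>t\<in>{0..1}.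
       \<bar>real_of_int (bfw_Ztilde N \<delta> H (nat \<lfloor>real N * t\<rfloor>)) / real N - zfun \<beta> (min t (tstar \<beta>))\<bar> \<le> r \<and>
       (t \<le> tstar \<beta> - \<zeta> \<longrightarrow> bfw_Ztilde N \<delta> H (nat \<lfloor>real N * t\<rfloor>) = bfw_Z N H (nat \<lfloor>real N * t\<rfloor>)))})
    \<longlonglongrightarrow> 0" (is "(\<lambda>N. measure_pmf.prob _ (?B N)) \<longlonglongrightarrow> 0")
proof -
  note zf = zfun_facts [OF \<beta> sm]
  have \<delta>1: "\<delta> < 1" by (rule delta_less_1 [OF k lim L])
  have "uniformly_continuous_on {0..1} (zfun \<beta>)"
    using zf(1) by (intro compact_uniformly_continuous) auto
  then have uc: "\<exists>d>0. \<forall>s\<in>{0..1}. \<forall>t\<in>{0..1}. \<bar>s - t\<bar> < d \<longrightarrow> \<bar>zfun \<beta> s - zfun \<beta> t\<bar> < a" if "a > 0" for a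
    using that unfolding uniformly_continuous_on_def dist_real_def by metis
  obtain d where d: "d > 0" "\<forall>s\<in>{0..1}. \<forall>t\<in>{0..1}. \<bar>s - t\<bar> < d \<longrightarrow> \<bar>zfun \<beta> s - zfun \<beta> t\<bar> < r / 4"
    using uc [of "r / 4"] r by auto
  define \<eta> where "\<eta> = min (d / 2) \<zeta>"
  have \<eta>: "\<eta> > 0" "\<eta> < d" "\<eta> \<le> \<zeta>" using d \<zeta> by (auto simp: \<eta>_def)
  obtain t' where t': "tstar \<beta> \<le> t'" "t' < tstar \<beta> + \<eta>" "t' < 1" "zfun \<beta> t' < 0"
    using zf(6) [OF \<eta>(1)] by blast
  define c where "c = - zfun \<beta> t'"
  have c: "c > 0" using t' by (simp add: c_def)
  obtain d' where d': "d' > 0" "\<forall>s\<in>{0..1}. \<forall>t\<in>{0..1}. \<bar>s - t\<bar> < d' \<longrightarrow> \<bar>zfun \<beta> s - zfun \<beta> t\<bar> < c / 4"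
    using uc [of "c / 4"] c by auto
  \<comment> \<open>On this compact interval z is nonnegative without zeros, so it has a positive
    minimum; if the interval is empty, any positive value serves.\<close>
  obtain \<kappa> where \<kappa>: "\<kappa> > 0" "\<And>s. \<delta> / 2 \<le> s \<Longrightarrow> s \<le> tstar \<beta> - \<eta> \<Longrightarrow> zfun \<beta> s \<ge> \<kappa>"
  proof (cases "\<delta> / 2 \<le> tstar \<beta> - \<eta>")
    case True
    let ?I = "{\<delta> / 2..tstar \<beta> - \<eta>}"
    have "continuous_on ?I (zfun \<beta>)"
      using \<delta> \<eta> zf(3) by (intro continuous_on_subset [OF zf(1)]) auto
    then obtain s0 where s0: "s0 \<in> ?I" "\<forall>s\<in>?I. zfun \<beta> s0 \<le> zfun \<beta> s"
      using continuous_attains_inf [of ?I "zfun \<beta>"] True by auto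
    have "0 < s0" "s0 < tstar \<beta>" using s0 \<delta> \<eta> by auto
    then have "zfun \<beta> s0 > 0" using zf(5) [of s0] nozero by (simp add: order_less_le)
    with that [of "zfun \<beta> s0"] s0 show ?thesis by auto
  next
    case False
    then show ?thesis using that [of 1] by auto
  qed
  define e where "e = min (r / 12) (min (c / 12) (\<kappa> / 4))"
  have e: "0 < e" "12 * e \<le> r" "12 * e \<le> c" "3 * e < \<kappa>"
    using r c \<kappa>(1) by (auto simp: e_def min_def)
  let ?KB = "\<lambda>N. {H. \<exists>i. real i \<le> real N * t' \<and>
        \<bar>bfw_K (survival \<beta> N) N H i / real N - exp (- beta_deriv \<beta> (real i / real N))\<bar> > e}"
  have KB: "(\<lambda>N. measure_pmf.prob (poisson_hypergraph \<beta> N) (?KB N)) \<longlonglongrightarrow> 0"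
    by (rule prob_K_dev_tendsto_0 [OF \<beta> sm t'(3) e(1)])
  have sub: "\<forall>\<^sub>F N in sequentially. ?B N \<subseteq> ?KB N \<union> S_event k N R \<delta>" for R
  proof -
    have "\<forall>\<^sub>F N in sequentially. real N powr (alpha k - 1) * R\<^sup>2 < e"
      by (rule order_tendstoD(2) [OF powr_scale_tendsto_0 [OF k] e(1)])
    moreover have "\<forall>\<^sub>F N in sequentially. 1 / real N < min (min e \<eta>) (min (d' / 2) (\<delta> / 2))"
      using e \<eta> d' \<delta> by (intro order_tendstoD(2) [OF lim_1_over_n]) auto
    ultimately show ?thesis using eventually_ge_at_top [of 1]
    proof eventually_elim
      case (elim N)
      then have Np: "real N > 0" by simp
      show ?case
      proof (rule subsetI, rule ccontr)
        fix H assume HB: "H \<in> ?B N" and nH: "H \<notin> ?KB N \<union> S_event k N R \<delta>"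
        have K: "\<bar>bfw_K (survival \<beta> N) N H i / real N - exp (- beta_deriv \<beta> (real i / real N))\<bar> \<le> e"
          if "real i \<le> real N * t'" for i
          using nH that by (auto simp: not_less)
        \<comment> \<open>Before time \<open>N powr alpha k * R\<^sup>2\<close>, which is below
          \<open>e N\<close>, the walk can have lost at most \<open>i\<close>; afterwards, outside
          \<open>S_event\<close>, it is positive up to time \<open>N * \<delta>\<close>.\<close>
        have Z: "real_of_int (bfw_Z N H i) \<ge> - e * real N" if "i \<le> nat \<lfloor>real N * \<delta>\<rfloor>" for i
        proof -
          have iN: "real i \<le> real N * \<delta>" using that \<delta> by (simp add: le_nat_floor le_nat_iff le_floor_iff)
          also have "\<dots> \<le> real N" using \<delta>1 Np by simp
          finally have "i \<le> N" by simp
          show ?thesis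
          proof (cases "real i \<ge> real N powr alpha k * R\<^sup>2")
            case True
            then have "\<not> bfw_Z N H i \<le> 0" using nH iN \<open>i \<le> N\<close> by (auto simp: S_event_def)
            moreover have "e * real N > 0" using e Np by simp
            ultimately show ?thesis by linarith
          next
            case False
            have "real N powr alpha k * R\<^sup>2 = real N * (real N powr (alpha k - 1) * R\<^sup>2)"
              using Np by (simp add: powr_diff)
            also have "\<dots> \<le> real N * e" using elim by (intro mult_left_mono) auto
            finally have "real i \<le> e * real N" using False by (simp add: mult.commute)
            moreover have "real_of_int (bfw_Z N H i) \<ge> - real i"
              using bfw_Z_ge [of i N H] by linarith
            ultimately show ?thesis by linarith
          qed
        qed
        have "\<bar>real_of_int (bfw_Ztilde N \<delta> H (nat \<lfloor>real N * t\<rfloor>)) / real N - zfun \<beta> (min t (tstar \<beta>))\<bar> \<le> r \<and>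
           (t \<le> tstar \<beta> - \<eta> \<longrightarrow> bfw_Ztilde N \<delta> H (nat \<lfloor>real N * t\<rfloor>) = bfw_Z N H (nat \<lfloor>real N * t\<rfloor>))"
          if t: "t \<in> {0..1}" for t
        proof -
          have o1: "\<bar>zfun \<beta> s - zfun \<beta> t\<bar> \<le> r / 4" if "s \<in> {0..1}" "t \<in> {0..1}" "\<bar>s - t\<bar> \<le> \<eta>" for s t
            using d(2) that \<eta>(2) by (simp add: less_imp_le)
          have o2: "\<bar>zfun \<beta> s - zfun \<beta> t\<bar> \<le> c / 4" if "s \<in> {0..1}" "t \<in> {0..1}" "\<bar>s - t\<bar> \<le> d' / 2" for s t
            using d' that by (simp add: less_imp_le)
          have N: "1 / real N \<le> e" "1 / real N \<le> \<eta>" "1 / real N \<le> d' / 2" "1 / real N \<le> \<delta> / 2"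
            using elim by auto
          have c': "zfun \<beta> t' \<le> - c" by (simp add: c_def)
          note Zn = Ztilde_near [OF \<beta> sm \<delta> e(1) e(2) e(3) e(4) o1 o2 t'(1) less_imp_le [OF t'(2)] t'(3) c' \<kappa>(2)
            \<open>1 \<le> N\<close> N K Z t]
          show ?thesis using Zn by simp
        qed
        moreover have "t \<le> tstar \<beta> - \<eta>" if "t \<le> tstar \<beta> - \<zeta>" for t using that \<eta>(3) by simp
        ultimately have "H \<notin> ?B N" by blast
        with HB show False by contradiction
      qed
    qed
  qed
  show ?thesis
  \<comment> \<open>\<open>R\<close> is fixed first, to make the limiting probability of
    \<open>S_event\<close> small, and only then does \<open>N\<close> grow.\<close>
  proof (rule tendstoI)
    fix a :: real assume a: "a > 0"
    then have "\<forall>\<^sub>F R in at_top. L R < a / 2"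
      by (intro order_tendstoD(2) [OF L]) simp
    then obtain R where R: "L R < a / 2" by (auto simp: eventually_at_top_linorder)
    have "\<forall>\<^sub>F N in sequentially. measure_pmf.prob (poisson_hypergraph \<beta> N) (S_event k N R \<delta>) < a / 2"
      using lim R by (intro order_tendstoD(2)) auto
    moreover have "\<forall>\<^sub>F N in sequentially. measure_pmf.prob (poisson_hypergraph \<beta> N) (?KB N) < a / 2"
      using a by (intro order_tendstoD(2) [OF KB]) auto
    ultimately show "\<forall>\<^sub>F N in sequentially. dist (measure_pmf.prob (poisson_hypergraph \<beta> N) (?B N)) 0 < a"
      using sub [of R]
    proof eventually_elim
      case (elim N)
      have "measure_pmf.prob (poisson_hypergraph \<beta> N) (?B N)
          \<le> measure_pmf.prob (poisson_hypergraph \<beta> N) (?KB N \<union> S_event k N R \<delta>)"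
        using elim(3) by (intro measure_pmf.finite_measure_mono) auto
      also have "\<dots> \<le> measure_pmf.prob (poisson_hypergraph \<beta> N) (?KB N)
          + measure_pmf.prob (poisson_hypergraph \<beta> N) (S_event k N R \<delta>)"
        by (intro measure_Un_le) auto
      also have "\<dots> < a" using elim by linarith
      finally show ?case by (simp add: dist_real_def)
    qed
  qed
qed

theorem theorem5p3:
  fixes \<beta> :: "nat \<Rightarrow> real" and k :: nat and \<delta> :: real
  assumes k3: "k \<ge> 3"
    and nonneg: "\<forall>j\<ge>2. \<beta> j \<ge> 0"
    and deriv_fin: "summable (\<lambda>j. real j * \<beta> j)"
    and crit: "\<forall>j. 2 \<le> j \<and> j \<le> k - 1 \<longrightarrow> \<beta> j = 1 / (real j * (real j - 1))"
    and supercrit: "\<beta> k > 1 / (real k * (real k - 1))"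
    and nozero: "\<forall>t. 0 < t \<and> t < tstar \<beta> \<longrightarrow> zfun \<beta> t \<noteq> 0"
    and \<delta>pos: "\<delta> > 0"
    and \<delta>lim: "\<exists>L :: real \<Rightarrow> real.
                 (\<forall>R. (\<lambda>N. measure_pmf.prob (poisson_hypergraph \<beta> N) (S_event k N R \<delta>))
                        \<longlonglongrightarrow> L R)
                 \<and> (L \<longlongrightarrow> 0) at_top"
  shows "(\<forall>\<epsilon>>0. (\<lambda>N. measure_pmf.prob (poisson_hypergraph \<beta> N)
            {H. (SUP t\<in>{0..1}. \<bar>real_of_int (bfw_Ztilde N \<delta> H (nat \<lfloor>real N * t\<rfloor>)) / real N
                                   - zfun \<beta> (min t (tstar \<beta>))\<bar>) > \<epsilon>})
           \<longlonglongrightarrow> 0)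
       \<and> (\<forall>\<sigma>. 0 < \<sigma> \<and> \<sigma> < tstar \<beta> \<longrightarrow>
           (\<forall>\<epsilon>>0. (\<lambda>N. measure_pmf.prob (poisson_hypergraph \<beta> N)
            {H. (SUP t\<in>{0..\<sigma>}. \<bar>real_of_int (bfw_Z N H (nat \<lfloor>real N * t\<rfloor>)) / real N
                                   - zfun \<beta> t\<bar>) > \<epsilon>})
           \<longlonglongrightarrow> 0))"
proof -
  obtain L where lim: "\<forall>R. (\<lambda>N. measure_pmf.prob (poisson_hypergraph \<beta> N) (S_event k N R \<delta>)) \<longlonglongrightarrow> L R"
    and L: "(L \<longlongrightarrow> 0) at_top" using \<delta>lim by blast
  have k2: "k \<ge> 2" using k3 by simp
  define good where "good N r \<zeta> H \<longleftrightarrow> (\<forall>t\<in>{0..1}.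
       \<bar>real_of_int (bfw_Ztilde N \<delta> H (nat \<lfloor>real N * t\<rfloor>)) / real N - zfun \<beta> (min t (tstar \<beta>))\<bar> \<le> r \<and>
       (t \<le> tstar \<beta> - \<zeta> \<longrightarrow> bfw_Ztilde N \<delta> H (nat \<lfloor>real N * t\<rfloor>) = bfw_Z N H (nat \<lfloor>real N * t\<rfloor>)))"
    for N r \<zeta> H
  have main: "(\<lambda>N. measure_pmf.prob (poisson_hypergraph \<beta> N) {H. \<not> good N r \<zeta> H}) \<longlonglongrightarrow> 0"
    if "r > 0" "\<zeta> > 0" for r \<zeta>
    unfolding good_def by (rule Ztilde_tendsto [OF k2 nonneg deriv_fin nozero \<delta>pos lim L that])
  have t1: "tstar \<beta> < 1" using zfun_facts(3) [OF nonneg deriv_fin] .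
  show ?thesis
  proof (intro conjI allI impI)
    fix \<epsilon> :: real assume \<epsilon>: "\<epsilon> > 0"
    show "(\<lambda>N. measure_pmf.prob (poisson_hypergraph \<beta> N)
            {H. (SUP t\<in>{0..1}. \<bar>real_of_int (bfw_Ztilde N \<delta> H (nat \<lfloor>real N * t\<rfloor>)) / real N
                                   - zfun \<beta> (min t (tstar \<beta>))\<bar>) > \<epsilon>}) \<longlonglongrightarrow> 0"
    proof (rule prob_tendsto_0 [OF always_eventually main [OF \<epsilon> zero_less_one]], rule allI,
        rule measure_pmf.finite_measure_mono)
      fix N
      have "(SUP t\<in>{0..1}. \<bar>real_of_int (bfw_Ztilde N \<delta> H (nat \<lfloor>real N * t\<rfloor>)) / real N
            - zfun \<beta> (min t (tstar \<beta>))\<bar>) \<le> \<epsilon>" if "good N \<epsilon> 1 H" for H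
        using that by (intro cSUP_least) (auto simp: good_def)
      then show "{H. (SUP t\<in>{0..1}. \<bar>real_of_int (bfw_Ztilde N \<delta> H (nat \<lfloor>real N * t\<rfloor>)) / real N
            - zfun \<beta> (min t (tstar \<beta>))\<bar>) > \<epsilon>} \<subseteq> {H. \<not> good N \<epsilon> 1 H}"
        by (force simp: not_less)
    qed simp
  next
    fix \<sigma> \<epsilon> :: real assume \<sigma>: "0 < \<sigma> \<and> \<sigma> < tstar \<beta>" and \<epsilon>: "\<epsilon> > 0"
    \<comment> \<open>With this choice the stopped walk and the original walk agree on all of
      \<open>{0..\<sigma>}\<close>.\<close>
    define \<zeta> where "\<zeta> = tstar \<beta> - \<sigma>"
    have \<zeta>: "\<zeta> > 0" using \<sigma> by (simp add: \<zeta>_def)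
    show "(\<lambda>N. measure_pmf.prob (poisson_hypergraph \<beta> N)
            {H. (SUP t\<in>{0..\<sigma>}. \<bar>real_of_int (bfw_Z N H (nat \<lfloor>real N * t\<rfloor>)) / real N
                                   - zfun \<beta> t\<bar>) > \<epsilon>}) \<longlonglongrightarrow> 0"
    proof (rule prob_tendsto_0 [OF always_eventually main [OF \<epsilon> \<zeta>]], rule allI,
        rule measure_pmf.finite_measure_mono)
      fix N
      have "(SUP t\<in>{0..\<sigma>}. \<bar>real_of_int (bfw_Z N H (nat \<lfloor>real N * t\<rfloor>)) / real N - zfun \<beta> t\<bar>) \<le> \<epsilon>"
        if good: "good N \<epsilon> \<zeta> H" for H
      proof (rule cSUP_least)
        fix t assume "t \<in> {0..\<sigma>}"
        then have "t \<in> {0..1}" "t \<le> tstar \<beta> - \<zeta>" "min t (tstar \<beta>) = t"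
          using \<sigma> t1 by (auto simp: \<zeta>_def)
        then show "\<bar>real_of_int (bfw_Z N H (nat \<lfloor>real N * t\<rfloor>)) / real N - zfun \<beta> t\<bar> \<le> \<epsilon>"
          using good unfolding good_def by metis
      qed (use \<sigma> in simp)
      then show "{H. (SUP t\<in>{0..\<sigma>}. \<bar>real_of_int (bfw_Z N H (nat \<lfloor>real N * t\<rfloor>)) / real N
            - zfun \<beta> t\<bar>) > \<epsilon>} \<subseteq> {H. \<not> good N \<epsilon> \<zeta> H}"
        by (force simp: not_less)
    qed simp
  qed
qed

end
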